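(* Let $N\le n$. Let $\mu_0=\sum_{i=1}^Nc_0^i\sigma^i\delta_{w_0^i}$, where $c_0^i>0$, $\sigma^i\in\{-1,+1\}$ and $w_0^i\in\overline{R}^{J_i}_{\pi^i}\cap\mathbb{S}^{d-1}$ (with $J_i\subset I$, $\pi^i\in\{0,1\}^n$) for $i=1,\dots,N$; let $y_0=K\mu_0$. Let $p_0$ be the minimal-norm solution of the dual interpolation problem $(D_0)$ and suppose that $\eta_0=K_*p_0$ is a dual certificate for $\mu_0$. Assume: (LC) $|\eta_0(w)|<1$ for all $w\in\mathbb{S}^{d-1}\setminus\{w_0^1,\dots,w_0^N\}$; (ND) for every $i$ such that $w_0^i\in R_\pi^{J}$ for some $\pi\in\{0,1\}^n$ and some $J\subsetneq I$, the following holds: for any two distinct strata $R^{J_1}_{\pi^1},R^{J_2}_{\pi^2}\in\mathcal F_\pi^{J}$ with $\tilde z_0(J_1,\pi^1)\ne0$ and $\tilde z_0(J_2,\pi^2)\neq 0$, $$\frac{\tilde z_0(J_1,\pi^1)}{\|\tilde z_0(J_1,\pi^1)\|}\neq\frac{\tilde z_0(J_2,\pi^2)}{\|\tilde z_0(J_2,\pi^2)\|};$$ and that $\{K\delta_{w_0^i}\}_{i=1}^N$ are linearly independent. Then there exist $\alpha>0$ and $\lambda_0>0$ such that, for all $(\lambda,\zeta)\in N_{\alpha,\lambda_0}$, there exists a unique collection of points $w_{\lambda,\zeta}^i\in\mathbb{S}^{d-1}$, $i=1,\dots,N$, such that any solution $\mu_{\lambda,\zeta}$ of the training problem $(P_\lambda)$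 with $y_\zeta=y_0+\zeta$ is of the form $$\mu_{\lambda,\zeta}=\sum_{i=1}^Nc_{\lambda,\zeta}^i\sigma^i\delta_{w_{\lambda,\zeta}^i},$$ where $c_{\lambda,\zeta}^i>0$ and $\eta_{\lambda,\zeta}(w_{\lambda,\zeta}^i)=\sigma^i$ for every $i=1,\dots,N$. Moreover (with the points suitably indexed), as $\lambda\to0$ with $\|\zeta\|\le\alpha\lambda$, for every $i=1,\dots,N$, $$w_{\lambda,\zeta}^i\to w_0^i,\qquad c_{\lambda,\zeta}^i\to c_0^i.$$
   Context: Setting. $d,n$ are positive integers, $x^1,\dots,x^n\in\mathbb{R}^d\setminus\{0\}$ are given data points, $I=\{1,\dots,n\}$, and $\sigma(z)=\max\{0,z\}$ is the ReLU function (the $\sigma^i$ are signs). $M(\mathbb{S}^{d-1})$ is the space of finite signed Radon measures on the unit sphere $\mathbb{S}^{d-1}\subset\mathbb{R}^d$, with total variation norm $\|\cdot\|_{\mathrm{TV}}$. $K:M(\mathbb{S}^{d-1})\to\mathbb{R}^n$ is $(K\mu)_j=\int_{\mathbb{S}^{d-1}}\sigma(\langle w,x^j\rangle)\,d\mu(w)$, and $K_*:\mathbb{R}^n\to C(\mathbb{S}^{d-1})$ is $K_*p(w)=\sum_{j=1}^np^j\sigma(\langle w,x^j\rangle)$. Dual interpolation problem $(D_0)$: maximize $\langle p,y_0\rangle$ over $p\in\mathbb{R}^n$ with $\|K_*p\|_\infty\le1$; its minimal-norm solution is the solution of smallest Euclidean norm. $\eta_0=K_*p_0$ is a dual certificate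 for $\mu_0$ if $\|\eta_0\|_\infty\le1$ and $\int\eta_0\,d\mu_0=\|\mu_0\|_{\mathrm{TV}}$ (so $\mu_0$ then minimizes $\|\mu\|_{\mathrm{TV}}$ subject to $K\mu=y_0$). Training problem $(P_\lambda)$, $\lambda>0$: minimize $\frac12\|K\mu-y_\zeta\|^2+\lambda\|\mu\|_{\mathrm{TV}}$ over $\mu\in M(\mathbb{S}^{d-1})$, with $y_\zeta=y_0+\zeta$. Its dual: maximize $\langle y_\zeta,p\rangle-\frac\lambda2\|p\|^2$ over $p\in\mathbb{R}^n$ with $\|K_*p\|_\infty\le1$; $p_{\lambda,\zeta}$ is its unique solution and $\eta_{\lambda,\zeta}=K_*p_{\lambda,\zeta}$. Admissible parameters: $N_{\alpha,\lambda_0}=\{(\lambda,\zeta)\in\mathbb{R}_+\times\mathbb{R}^n:0<\lambda\le\lambda_0,\ \|\zeta\|\le\alpha\lambda\}$. Strata. For $i\in I$ let $H_i=\{w\in\mathbb{R}^d:\langle w,x^i\rangle=0\}$, $A_i^1=\{w\in\mathbb{R}^d:\langle w,x^i\rangle>0\}$, $A_i^0=\{w\in\mathbb{R}^d:\langle w,x^i\rangle<0\}$. For $\pi\in\{0,1\}^n$ and $J\subset I$, $R_\pi^J=\big(\bigcap_{j\in J}A_j^{\pi_j}\big)\cap\big(\bigcap_{z\in I\setminus J}H_z\big)$, $L^J=\bigcap_{z\in I\setminus J}H_z$ (with $L^I=\mathbb{R}^d$), and $\overline R_\pi^J$ is the closure of $R_\pi^J$ in $L^J$. The compatible family of strata is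 $$\mathcal F_\pi^J=\{R^{J'}_{\bar\pi}:\ R^{J'}_{\bar\pi}\ne\emptyset,\ J\subset J'\subset I,\ \bar\pi_j=\pi_j\ \forall j\in J\}.$$ For a stratum $R^{J'}_{\bar\pi}$, $\tilde z_0(J',\bar\pi)=P_{J'}\big(\sum_{j\in J'}p_0^j\bar\pi_jx^j\big)$, where $P_{J'}$ is the orthogonal projection onto $L^{J'}$. *)

theory Defs
  imports "HOL-Analysis.Analysis" "HOL-Combinatorics.Permutations"
begin

section \<open>Finite signed measures on the unit sphere\<close>

abbreviation usphere :: "(real^'d) set" where
  "usphere \<equiv> sphere 0 1"

definition sphere_borel :: "(real^'d) measure" where
  "sphere_borel = restrict_space borel usphere"

text \<open>
  A finite signed measure is a real-valued, countably additive function on the Borel sets of the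
  sphere. It is set to 0 on all other sets, so that equality of measures is equality in HOL.
  The sphere is a compact metric space, so every such measure is Radon.
\<close>
definition sphere_measures :: "((real^'d) set \<Rightarrow> real) set" where
  "sphere_measures =
    {\<nu>. (\<forall>A::nat \<Rightarrow> (real^'d) set. range A \<subseteq> sets sphere_borel \<longrightarrow> disjoint_family A \<longrightarrow>
            (\<lambda>k. \<nu> (A k)) sums \<nu> (\<Union>k. A k)) \<and>
         (\<forall>A. A \<notin> sets sphere_borel \<longrightarrow> \<nu> A = 0)}"

text \<open>
  The Jordan decomposition: \<open>pos_part \<nu>\<close> and \<open>neg_part \<nu>\<close> are the upper and lower variations.
  Since \<open>ennreal\<close> truncates negative reals to 0, the suprema are unaffected by it (the empty set
  already contributes 0).
\<close>
definition pos_part :: "((real^'d) set \<Rightarrow> real) \<Rightarrow> (real^'d) measure" where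
  "pos_part \<nu> = measure_of usphere (sets sphere_borel)
     (\<lambda>A. SUP B \<in> {B \<in> sets sphere_borel. B \<subseteq> A}. ennreal (\<nu> B))"

definition neg_part :: "((real^'d) set \<Rightarrow> real) \<Rightarrow> (real^'d) measure" where
  "neg_part \<nu> = pos_part (\<lambda>A. - \<nu> A)"

definition tv_norm :: "((real^'d) set \<Rightarrow> real) \<Rightarrow> real" where
  "tv_norm \<nu> = measure (pos_part \<nu>) usphere + measure (neg_part \<nu>) usphere"

definition signed_integral :: "((real^'d) set \<Rightarrow> real) \<Rightarrow> (real^'d \<Rightarrow> real) \<Rightarrow> real" where
  "signed_integral \<nu> f = (\<integral>w. f w \<partial>pos_part \<nu>) - (\<integral>w. f w \<partial>neg_part \<nu>)"

definition dirac :: "real^'d \<Rightarrow> (real^'d) set \<Rightarrow> real" where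
  "dirac w A = (if A \<in> sets sphere_borel then indicator A w else 0)"

section \<open>The training problem and its dual\<close>

text \<open>
  The data are \<open>x :: 'n \<Rightarrow> real^'d\<close>, with the finite type \<open>'n\<close> as index set
  (\<open>CARD('n)\<close> data points).
\<close>

definition relu :: "real \<Rightarrow> real" where
  "relu z = max 0 z"

definition K_op :: "('n::finite \<Rightarrow> real^'d) \<Rightarrow> ((real^'d) set \<Rightarrow> real) \<Rightarrow> real^'n" where
  "K_op x \<mu> = (\<chi> j. signed_integral \<mu> (\<lambda>w. relu (w \<bullet> x j)))"

definition K_adj :: "('n::finite \<Rightarrow> real^'d) \<Rightarrow> real^'n \<Rightarrow> real^'d \<Rightarrow> real" where
  "K_adj x p w = (\<Sum>j\<in>UNIV. p $ j * relu (w \<bullet> x j))"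

definition sup_norm :: "(real^'d \<Rightarrow> real) \<Rightarrow> real" where
  "sup_norm f = (SUP w\<in>usphere. \<bar>f w\<bar>)"

definition dual_feasible :: "('n::finite \<Rightarrow> real^'d) \<Rightarrow> real^'n \<Rightarrow> bool" where
  "dual_feasible x p \<longleftrightarrow> sup_norm (K_adj x p) \<le> 1"

definition dual_interpolation_solution ::
  "('n::finite \<Rightarrow> real^'d) \<Rightarrow> real^'n \<Rightarrow> real^'n \<Rightarrow> bool" where
  "dual_interpolation_solution x y p \<longleftrightarrow> is_arg_max (\<lambda>p. p \<bullet> y) (dual_feasible x) p"

definition minimal_norm_dual_solution ::
  "('n::finite \<Rightarrow> real^'d) \<Rightarrow> real^'n \<Rightarrow> real^'n \<Rightarrow> bool" where
  "minimal_norm_dual_solution x y p \<longleftrightarrow> is_arg_min norm (dual_interpolation_solution x y) p"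

definition dual_certificate :: "(real^'d \<Rightarrow> real) \<Rightarrow> ((real^'d) set \<Rightarrow> real) \<Rightarrow> bool" where
  "dual_certificate \<eta> \<mu> \<longleftrightarrow> sup_norm \<eta> \<le> 1 \<and> signed_integral \<mu> \<eta> = tv_norm \<mu>"

definition training_solution ::
  "('n::finite \<Rightarrow> real^'d) \<Rightarrow> real \<Rightarrow> real^'n \<Rightarrow> ((real^'d) set \<Rightarrow> real) \<Rightarrow> bool" where
  "training_solution x l y \<mu> \<longleftrightarrow>
     is_arg_min (\<lambda>\<mu>. 1/2 * (norm (K_op x \<mu> - y))\<^sup>2 + l * tv_norm \<mu>) (\<lambda>\<mu>. \<mu> \<in> sphere_measures) \<mu>"

definition training_dual_solution :: "('n::finite \<Rightarrow> real^'d) \<Rightarrow> real \<Rightarrow> real^'n \<Rightarrow> real^'n" where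
  "training_dual_solution x l y =
     (THE p. is_arg_max (\<lambda>p. y \<bullet> p - l/2 * (norm p)\<^sup>2) (dual_feasible x) p)"

definition admissible :: "real \<Rightarrow> real \<Rightarrow> (real \<times> (real^'n::finite)) set" where
  "admissible \<alpha> l0 = {(l, \<zeta>). 0 < l \<and> l \<le> l0 \<and> norm \<zeta> \<le> \<alpha> * l}"

section \<open>Strata\<close>

text \<open>Vectors in \<open>{0,1}\<^sup>n\<close> are represented as functions \<open>'n \<Rightarrow> bool\<close>, with \<open>True\<close> for 1.\<close>

definition hyperplane :: "('n::finite \<Rightarrow> real^'d) \<Rightarrow> 'n \<Rightarrow> (real^'d) set" where
  "hyperplane x i = {w. w \<bullet> x i = 0}"

definition half_space :: "('n::finite \<Rightarrow> real^'d) \<Rightarrow> 'n \<Rightarrow> bool \<Rightarrow> (real^'d) set" where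
  "half_space x i b = (if b then {w. w \<bullet> x i > 0} else {w. w \<bullet> x i < 0})"

definition L_space :: "('n::finite \<Rightarrow> real^'d) \<Rightarrow> 'n set \<Rightarrow> (real^'d) set" where
  "L_space x J = (\<Inter>z\<in>UNIV - J. hyperplane x z)"

definition stratum :: "('n::finite \<Rightarrow> real^'d) \<Rightarrow> ('n \<Rightarrow> bool) \<Rightarrow> 'n set \<Rightarrow> (real^'d) set" where
  "stratum x \<pi> J = (\<Inter>j\<in>J. half_space x j (\<pi> j)) \<inter> (\<Inter>z\<in>UNIV - J. hyperplane x z)"

definition closed_stratum ::
  "('n::finite \<Rightarrow> real^'d) \<Rightarrow> ('n \<Rightarrow> bool) \<Rightarrow> 'n set \<Rightarrow> (real^'d) set" where
  "closed_stratum x \<pi> J = top_of_set (L_space x J) closure_of stratum x \<pi> J"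

definition compatible_strata ::
  "('n::finite \<Rightarrow> real^'d) \<Rightarrow> ('n \<Rightarrow> bool) \<Rightarrow> 'n set \<Rightarrow> (real^'d) set set" where
  "compatible_strata x \<pi> J =
     {stratum x \<pi>' J' | \<pi>' J'. stratum x \<pi>' J' \<noteq> {} \<and> J \<subseteq> J' \<and> (\<forall>j\<in>J. \<pi>' j = \<pi> j)}"

definition orth_proj :: "(real^'d) set \<Rightarrow> real^'d \<Rightarrow> real^'d" where
  "orth_proj L v = (THE u. u \<in> L \<and> (\<forall>z\<in>L. orthogonal (v - u) z))"

definition z_tilde ::
  "('n::finite \<Rightarrow> real^'d) \<Rightarrow> real^'n \<Rightarrow> 'n set \<Rightarrow> ('n \<Rightarrow> bool) \<Rightarrow> real^'d" where
  "z_tilde x p J \<pi> = orth_proj (L_space x J) (\<Sum>j\<in>J. (p $ j * of_bool (\<pi> j)) *\<^sub>R x j)"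

section \<open>Solutions as sums of point masses\<close>

definition represents_solutions ::
  "('n::finite \<Rightarrow> real^'d) \<Rightarrow> nat \<Rightarrow> (nat \<Rightarrow> real) \<Rightarrow> real \<Rightarrow> real^'n \<Rightarrow> (nat \<Rightarrow> real^'d) \<Rightarrow> bool" where
  "represents_solutions x N \<sigma> l y w \<longleftrightarrow>
     (\<forall>i\<in>{1..N}. w i \<in> usphere) \<and>
     (\<forall>\<mu>. training_solution x l y \<mu> \<longrightarrow>
        (\<exists>c. \<mu> = (\<lambda>A. \<Sum>i=1..N. c i * \<sigma> i * dirac (w i) A) \<and>
             (\<forall>i\<in>{1..N}. c i > 0 \<and> K_adj x (training_dual_solution x l y) (w i) = \<sigma> i)))"

end

theory Submission imports Defs
begin

text \<open>
  Every solution of the training problem is concentrated on the set where the perturbed certificate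
  \<open>K_adj x p\<close> has absolute value 1, \<open>p\<close> being the dual solution. For small \<open>\<alpha>\<close> and \<open>l\<close> this \<open>p\<close> is
  close to \<open>p0\<close>, so by (LC) these saturated points lie near the \<open>w0 i\<close>. Near \<open>w0 i\<close> there is at most
  one: two in the same stratum are excluded because \<open>K_adj x p\<close> is linear there and a chord of the
  sphere enters the open ball; and a stratum containing saturated points arbitrarily close to
  \<open>w0 i\<close> has \<open>z_tilde\<close> equal to \<open>\<sigma> i *\<^sub>R w0 i\<close>, so by (ND) there is only one such stratum.
  Linear independence then forces the weights to be close to \<open>c0\<close>, hence positive, so that every
  \<open>w0 i\<close> really has a saturated point nearby.
\<close>

section \<open>Jordan decomposition\<close>

text \<open>Continuation from \<open>w0 i\<close> by an implicit function theorem is blocked: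
  \<open>kvec x\<close> has kinks where some \<open>w \<bullet> x j\<close> vanishes, and
  \<open>w0 i\<close> may lie there. Location, sign and existence of the nearby saturated points are
  therefore all extracted from an arbitrary solution of the perturbed problem. The noise is allowed
  to be of the same order as the regularisation. With \<open>\<zeta> = l *\<^sub>R v\<close> the
  dual objective is \<open>p \<bullet> y0 + l * (v \<bullet> p - (norm p)\<^sup>2 / 2)\<close>; for
  small \<open>l\<close> its maximiser is drawn to the projection of \<open>v\<close> onto the
  maximisers of \<open>p \<bullet> y0\<close>, and \<open>p0\<close> is the projection of 0. A small
  \<alpha> thus keeps the dual vector near \<open>p0\<close> without making it converge, so local
  uniqueness must hold for all dual vectors in a ball, and the limits of the points need an argument
  of their own. The data residual of a solution is \<open>\<zeta> - l *\<^sub>R p\<close>, of size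
  O(l); this controls the weights. The constants are fixed in the order \<open>r\<close>, \<delta>,
  \<alpha>, \<open>l0\<close>, the radius \<open>r\<close> being small relative to the weights
  \<open>c0 i\<close>.\<close>

lemma space_sphere_borel [simp]: "space sphere_borel = usphere"
  by (simp add: sphere_borel_def space_restrict_space)

lemma sets_sphere_borel_subset: "A \<in> sets sphere_borel \<Longrightarrow> A \<subseteq> usphere"
  using sets.sets_into_space by fastforce

lemma sets_sphere_borel_singleton: "w \<in> usphere \<Longrightarrow> {w} \<in> sets sphere_borel"
  by (auto simp: sphere_borel_def sets_restrict_space intro!: image_eqI[where x = "{w}"])

lemma sets_sphere_borel_finite:
  assumes "finite W" "W \<subseteq> usphere" shows "W \<in> sets sphere_borel"
  using assms by (induction W) (auto intro!: sets.insert_in_sets sets_sphere_borel_singleton)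

context
  fixes \<nu> :: "(real^'d) set \<Rightarrow> real"
  assumes nu: "\<nu> \<in> sphere_measures"
begin

lemma sphere_measure_sums:
  fixes A :: "nat \<Rightarrow> (real^'d) set"
  shows "range A \<subseteq> sets sphere_borel \<Longrightarrow> disjoint_family A \<Longrightarrow> (\<lambda>k. \<nu> (A k)) sums \<nu> (\<Union>k. A k)"
  using nu by (auto simp: sphere_measures_def)

lemma sphere_measure_empty: "\<nu> {} = 0"
proof -
  have "(\<lambda>k::nat. \<nu> {}) sums \<nu> (\<Union>k::nat. {})"
    by (rule sphere_measure_sums) (auto simp: disjoint_family_on_def)
  then have "(\<lambda>k::nat. \<nu> {}) \<longlonglongrightarrow> 0"
    by (intro summable_LIMSEQ_zero) (auto simp: sums_iff)
  then show ?thesis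
    by (simp add: LIMSEQ_const_iff)
qed

lemma sphere_measure_Un:
  assumes "A \<in> sets sphere_borel" "B \<in> sets sphere_borel" "A \<inter> B = {}"
  shows "\<nu> (A \<union> B) = \<nu> A + \<nu> B"
proof -
  have "(\<lambda>k. \<nu> (binaryset A B k)) sums \<nu> (\<Union>k. binaryset A B k)"
    using assms by (intro sphere_measure_sums)
      (auto simp: range_binaryset_eq disjoint_family_on_def binaryset_def)
  moreover have "(\<lambda>k. \<nu> (binaryset A B k)) sums (\<nu> A + \<nu> B)"
    by (rule binaryset_sums) (simp add: sphere_measure_empty)
  ultimately show ?thesis
    using sums_unique2 by (auto simp: UN_binaryset_eq)
qed

lemma sphere_measure_Diff:
  assumes "A \<in> sets sphere_borel" "B \<in> sets sphere_borel" "B \<subseteq> A"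
  shows "\<nu> (A - B) = \<nu> A - \<nu> B"
proof -
  have "(A - B) \<union> B = A"
    using assms by auto
  then show ?thesis
    using sphere_measure_Un[of "A - B" B] assms by (simp add: Diff_Int_distrib2)
qed

lemma sphere_measure_uminus: "(\<lambda>A. - \<nu> A) \<in> sphere_measures"
  using nu by (auto simp: sphere_measures_def sums_minus)

abbreviation (input) upper_variation :: "(real^'d) set \<Rightarrow> ennreal" where
  "upper_variation A \<equiv> (SUP B \<in> {B \<in> sets sphere_borel. B \<subseteq> A}. ennreal (\<nu> B))"

text \<open>A competitor \<open>B\<close> inside the union splits into the traces
  \<open>B \<inter> A k\<close>, whose masses sum to \<open>\<nu> B\<close>; conversely, competitors
  inside disjoint sets unite to a competitor for the union.\<close>

lemma upper_variation_countably_additive: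
  "countably_additive (sets sphere_borel) (\<lambda>A. upper_variation A)"
proof (rule countably_additiveI)
  fix A :: "nat \<Rightarrow> (real^'d) set"
  assume A: "range A \<subseteq> sets sphere_borel" and disj: "disjoint_family A"
  show "(\<Sum>k. upper_variation (A k)) = upper_variation (\<Union>k. A k)"
  proof (rule antisym)
    show "upper_variation (\<Union>k. A k) \<le> (\<Sum>k. upper_variation (A k))"
    proof (rule SUP_least, clarify)
      fix B assume B: "B \<in> sets sphere_borel" "B \<subseteq> (\<Union>k. A k)"
      have meas: "range (\<lambda>k. B \<inter> A k) \<subseteq> sets sphere_borel"
        using A B by auto
      have "(\<lambda>k. \<nu> (B \<inter> A k)) sums \<nu> (\<Union>k. B \<inter> A k)"
        using disj meas by (intro sphere_measure_sums) (auto simp: disjoint_family_on_def)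
      moreover have "(\<Union>k. B \<inter> A k) = B"
        using B by auto
      ultimately have s: "(\<lambda>k. \<nu> (B \<inter> A k)) sums \<nu> B"
        by simp
      have bound: "(\<Sum>k<m. ennreal (\<nu> (B \<inter> A k))) \<le> (\<Sum>k. upper_variation (A k))" for m
      proof -
        have "(\<Sum>k<m. ennreal (\<nu> (B \<inter> A k))) \<le> (\<Sum>k<m. upper_variation (A k))"
          using meas by (intro sum_mono SUP_upper) auto
        also have "\<dots> \<le> (\<Sum>k. upper_variation (A k))"
          by (intro sum_le_suminf) auto
        finally show ?thesis .
      qed
      have "ennreal (\<Sum>k<m. \<nu> (B \<inter> A k)) \<le> (\<Sum>k. upper_variation (A k))" for m
      proof -
        have "ennreal (\<Sum>k<m. \<nu> (B \<inter> A k)) \<le> ennreal (\<Sum>k<m. max 0 (\<nu> (B \<inter> A k)))"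
          by (intro ennreal_leI sum_mono) auto
        also have "\<dots> = (\<Sum>k<m. ennreal (\<nu> (B \<inter> A k)))"
          by (subst sum_ennreal[symmetric]) (simp_all add: ennreal_max_0)
        finally show ?thesis
          using bound[of m] by (rule order_trans)
      qed
      moreover have "(\<lambda>m. ennreal (\<Sum>k<m. \<nu> (B \<inter> A k))) \<longlonglongrightarrow> ennreal (\<nu> B)"
        using s by (intro tendsto_ennrealI) (simp add: sums_def)
      ultimately show "ennreal (\<nu> B) \<le> (\<Sum>k. upper_variation (A k))"
        by (intro LIMSEQ_le_const2) auto
    qed
    have fin: "(\<Sum>k<m. upper_variation (A k)) \<le> upper_variation (\<Union>k. A k)" for m :: nat
    proof -
      have add: "upper_variation E + upper_variation F \<le> upper_variation (E \<union> F)"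
        if EF: "E \<in> sets sphere_borel" "F \<in> sets sphere_borel" "E \<inter> F = {}" for E F
      proof -
        have key: "ennreal (\<nu> B) + ennreal (\<nu> D) \<le> upper_variation (E \<union> F)"
          if "B \<in> sets sphere_borel" "B \<subseteq> E" "D \<in> sets sphere_borel" "D \<subseteq> F" for B D
        proof -
          \<comment> \<open>Masses may be negative and are then truncated to 0, so the sum of the
            two truncated masses is attained by \<open>B \<union> D\<close>, by \<open>B\<close> or
            \<open>D\<close> alone, or is 0.\<close>
          have *: "ennreal (\<nu> X) \<le> upper_variation (E \<union> F)" 
            if "X \<in> {B, D, B \<union> D}" for X
            using that \<open>B \<in> _\<close> \<open>B \<subseteq> E\<close> \<open>D \<in> _\<close> \<open>D \<subseteq> F\<close> by (intro SUP_upper) auto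
          have "B \<inter> D = {}"
            using that EF by auto
          then have "\<nu> (B \<union> D) = \<nu> B + \<nu> D"
            using that by (intro sphere_measure_Un) auto
          then show ?thesis
            using *[of B] *[of D] *[of "B \<union> D"]
            by (cases "\<nu> B \<ge> 0"; cases "\<nu> D \<ge> 0") (auto simp: ennreal_neg ennreal_plus)
        qed
        show ?thesis
          by (subst ennreal_SUP_add_left[symmetric], force, rule SUP_least,
              subst ennreal_SUP_add_right, force, rule SUP_least) (auto intro: key)
      qed
      have meas: "(\<Union>k<m. A k) \<in> sets sphere_borel" for m
        using A by (intro sets.finite_UN) auto
      have "(\<Sum>k<m. upper_variation (A k)) \<le> upper_variation (\<Union>k<m. A k)"
      proof (induction m)
        case (Suc m)
        have "(\<Sum>k<Suc m. upper_variation (A k)) \<le> upper_variation (\<Union>k<m. A k) + upper_variation (A m)"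
          using Suc by (simp add: add_right_mono)
        also have "\<dots> \<le> upper_variation ((\<Union>k<m. A k) \<union> A m)"
        proof (rule add)
          show "(\<Union>k<m. A k) \<inter> A m = {}"
            using disj by (auto simp: disjoint_family_on_def) (metis IntI empty_iff nat_neq_iff)
        qed (use A meas in auto)
        also have "(\<Union>k<m. A k) \<union> A m = (\<Union>k<Suc m. A k)"
          by (auto simp: less_Suc_eq)
        finally show ?case .
      qed simp
      also have "\<dots> \<le> upper_variation (\<Union>k. A k)"
        by (intro SUP_subset_mono) auto
      finally show ?thesis .
    qed
    show "(\<Sum>k. upper_variation (A k)) \<le> upper_variation (\<Union>k. A k)"
      by (intro suminf_le_const fin) auto
  qed
qed

lemma sets_pos_part [simp]: "sets (pos_part \<nu>) = sets sphere_borel"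
  using sets.space_closed[of "sphere_borel :: (real^'d) measure"]
    sets.sigma_sets_eq[of "sphere_borel :: (real^'d) measure"]
  by (simp add: pos_part_def sets_measure_of)

lemma space_pos_part [simp]: "space (pos_part \<nu>) = usphere"
  using sets_eq_imp_space_eq[OF sets_pos_part] by simp

lemma emeasure_pos_part:
  assumes "A \<in> sets sphere_borel"
  shows "emeasure (pos_part \<nu>) A = upper_variation A"
  unfolding pos_part_def
proof (rule emeasure_measure_of_sigma)
  show "sigma_algebra usphere (sets (sphere_borel :: (real^'d) measure))"
    using sets.sigma_algebra_axioms[of sphere_borel] by simp
  show "positive (sets sphere_borel) (\<lambda>A. upper_variation A)"
    using sphere_measure_empty by (auto simp: positive_def)
  show "countably_additive (sets sphere_borel) (\<lambda>A. upper_variation A)"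
    by (rule upper_variation_countably_additive)
qed (use assms in auto)

text \<open>
  If the upper variation were infinite, one could split off sets of mass at least 1 forever,
  always keeping a remainder of infinite variation; this contradicts convergence of the series.
\<close>
lemma finite_measure_pos_part: "finite_measure (pos_part \<nu>)"
proof (rule finite_measureI, rule ccontr)
  assume "\<not> emeasure (pos_part \<nu>) (space (pos_part \<nu>)) \<noteq> \<infinity>"
  then have top: "emeasure (pos_part \<nu>) usphere = \<infinity>"
    by simp
  let ?P = "\<lambda>E. E \<in> sets sphere_borel \<and> emeasure (pos_part \<nu>) E = \<infinity>"
  have step: "\<exists>F. ?P F \<and> F \<subseteq> E \<and> \<bar>\<nu> (E - F)\<bar> > 1" if E: "?P E" for E
  proof -
    \<comment> \<open>With this threshold both \<open>\<nu> B > 1\<close> and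
      \<open>\<nu> (E - B) < -1\<close>. Whichever of \<open>B\<close> and \<open>E - B\<close>
      keeps infinite variation, the discarded piece has mass of modulus above 1.\<close>
    have "ennreal (1 + \<bar>\<nu> E\<bar>) < upper_variation E"
      using E emeasure_pos_part[of E] by simp
    then obtain B where B: "B \<in> sets sphere_borel" "B \<subseteq> E" and
      "ennreal (1 + \<bar>\<nu> E\<bar>) < ennreal (\<nu> B)"
      by (auto simp: less_SUP_iff)
    then have nuB: "1 + \<bar>\<nu> E\<bar> < \<nu> B"
      by (meson abs_ge_zero add_nonneg_nonneg ennreal_less_iff zero_le_one)
    have "emeasure (pos_part \<nu>) E = emeasure (pos_part \<nu>) B + emeasure (pos_part \<nu>) (E - B)"
      using B E by (subst plus_emeasure) (auto simp: Un_absorb1)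
    then consider "?P B" | "?P (E - B)"
      using E B by (auto simp: eq_commute[of top])
    then show ?thesis
    proof cases
      case 1
      then show ?thesis
        using B E nuB sphere_measure_Diff[of E B] by (intro exI[of _ B]) auto
    next
      case 2
      moreover have "E - (E - B) = B"
        using B by auto
      ultimately show ?thesis
        using nuB by (intro exI[of _ "E - B"]) auto
    qed
  qed
  have "\<exists>f. \<forall>k::nat. ?P (f k) \<and> f (Suc k) \<subseteq> f k \<and> \<bar>\<nu> (f k - f (Suc k))\<bar> > 1"
    using step top by (intro dependent_nat_choice)
      (auto intro!: exI[of _ usphere] sets.top[of sphere_borel, simplified])
  then obtain f :: "nat \<Rightarrow> (real^'d) set"
    where f: "\<And>k. ?P (f k)" "\<And>k. f (Suc k) \<subseteq> f k" "\<And>k. \<bar>\<nu> (f k - f (Suc k))\<bar> > 1"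
    by blast
  have mono: "f m \<subseteq> f k" if "k \<le> m" for k m
    using f(2) that by (rule lift_Suc_antimono_le)
  have "disjoint_family (\<lambda>k. f k - f (Suc k))"
    unfolding disjoint_family_on_def
  proof (intro ballI impI)
    fix k m :: nat assume "k \<noteq> m"
    then show "(f k - f (Suc k)) \<inter> (f m - f (Suc m)) = {}"
      using mono[of "Suc k" m] mono[of "Suc m" k] by (cases "k < m") auto
  qed
  then have "(\<lambda>k. \<nu> (f k - f (Suc k))) sums \<nu> (\<Union>k. f k - f (Suc k))"
    using f(1) by (intro sphere_measure_sums) auto
  then have "(\<lambda>k. \<nu> (f k - f (Suc k))) \<longlonglongrightarrow> 0"
    by (intro summable_LIMSEQ_zero) (auto simp: sums_iff)
  then have "\<forall>\<^sub>F k in sequentially. \<bar>\<nu> (f k - f (Suc k))\<bar> < 1"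
    by (auto simp: tendsto_iff dist_real_def dest: spec[of _ 1])
  then obtain k where "\<bar>\<nu> (f k - f (Suc k))\<bar> < 1"
    by (auto simp: eventually_sequentially)
  then show False
    using f(3)[of k] by simp
qed

end

lemma neg_part_props:
  fixes \<nu> :: "(real^'d) set \<Rightarrow> real"
  assumes "\<nu> \<in> sphere_measures"
  shows space_neg_part: "space (neg_part \<nu>) = usphere"
    and finite_measure_neg_part: "finite_measure (neg_part \<nu>)"
  using sphere_measure_uminus[OF assms]
  by (simp_all add: neg_part_def finite_measure_pos_part)

text \<open>For \<open>B \<subseteq> A\<close> one has
  \<open>\<nu> B = \<nu> A - \<nu> (A - B)\<close>, which is at most \<nu> of \<open>A\<close> plus
  the lower variation of \<open>A\<close>. The supremum over \<open>B\<close> gives one inequality;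
  the same argument for \<open>- \<nu>\<close> gives the other.\<close>

lemma sphere_measure_eq_diff:
  fixes \<nu> :: "(real^'d) set \<Rightarrow> real"
  assumes nu: "\<nu> \<in> sphere_measures" and A: "A \<in> sets sphere_borel"
  shows "\<nu> A = measure (pos_part \<nu>) A - measure (neg_part \<nu>) A"
proof -
  interpret P: finite_measure "pos_part \<nu>" by (rule finite_measure_pos_part[OF nu])
  interpret N: finite_measure "neg_part \<nu>" by (rule finite_measure_neg_part[OF nu])
  note nu' = sphere_measure_uminus[OF nu]
  have P: "\<nu> B \<le> measure (pos_part \<nu>) A" if "B \<in> sets sphere_borel" "B \<subseteq> A" for B
  proof -
    have "ennreal (\<nu> B) \<le> emeasure (pos_part \<nu>) A"
      using that A by (auto simp: emeasure_pos_part[OF nu] intro!: SUP_upper)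
    then show ?thesis
      by (simp add: P.emeasure_eq_measure)
  qed
  have N: "- \<nu> B \<le> measure (neg_part \<nu>) A" if "B \<in> sets sphere_borel" "B \<subseteq> A" for B
  proof -
    have "ennreal (- \<nu> B) \<le> emeasure (neg_part \<nu>) A"
      using that A by (auto simp: neg_part_def emeasure_pos_part[OF nu'] intro!: SUP_upper)
    then show ?thesis
      by (simp add: N.emeasure_eq_measure)
  qed
  have "emeasure (pos_part \<nu>) A \<le> ennreal (\<nu> A + measure (neg_part \<nu>) A)"
    unfolding emeasure_pos_part[OF nu A]
    using N[of "A - _"] sphere_measure_Diff[OF nu A] A
    by (intro SUP_least ennreal_leI) force
  moreover have "emeasure (neg_part \<nu>) A \<le> ennreal (measure (pos_part \<nu>) A - \<nu> A)"
    unfolding neg_part_def emeasure_pos_part[OF nu' A]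
    using P[of "A - _"] sphere_measure_Diff[OF nu A] A
    by (intro SUP_least ennreal_leI) force
  moreover have "0 \<le> \<nu> A + measure (neg_part \<nu>) A" "0 \<le> measure (pos_part \<nu>) A - \<nu> A"
    using P[OF A] N[OF A] by auto
  ultimately show ?thesis
    by (simp add: P.emeasure_eq_measure N.emeasure_eq_measure)
qed

section \<open>Integration against the two Jordan parts\<close>

lemma borel_measurable_sphere:
  assumes "continuous_on UNIV f"
  shows "f \<in> borel_measurable sphere_borel"
  unfolding sphere_borel_def
  by (rule measurable_restrict_space1) (rule borel_measurable_continuous_onI[OF assms])

lemma integrable_pos_part:
  fixes f :: "real^'d \<Rightarrow> real"
  assumes nu: "\<nu> \<in> sphere_measures" and f: "continuous_on UNIV f"
  shows "integrable (pos_part \<nu>) f"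
proof -
  interpret P: finite_measure "pos_part \<nu>" by (rule finite_measure_pos_part[OF nu])
  have "compact (f ` usphere)"
    using f by (intro compact_continuous_image) (auto intro: continuous_on_subset)
  then obtain B where "\<And>w. w \<in> usphere \<Longrightarrow> norm (f w) \<le> B"
    by (meson bounded_iff compact_imp_bounded imageI)
  then show ?thesis
    using borel_measurable_sphere[OF f]
    by (intro P.integrable_const_bound[where B = B])
      (auto simp: space_pos_part[OF nu] measurable_cong_sets[OF sets_pos_part[OF nu] refl])
qed

lemma integrable_neg_part:
  fixes f :: "real^'d \<Rightarrow> real"
  assumes "\<nu> \<in> sphere_measures" "continuous_on UNIV f"
  shows "integrable (neg_part \<nu>) f"
  unfolding neg_part_def by (intro integrable_pos_part sphere_measure_uminus assms)

text \<open>The difference of the two sides is the integral of \<open>1 - f\<close> over the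
  positive part plus that of \<open>1 + f\<close> over the negative part, both with nonnegative
  integrands. Equality makes them vanish almost everywhere, whereas both are positive where
  \<open>\<bar>f w\<bar> < 1\<close>. The second claim is what locates the support of
  solutions.\<close>

lemma signed_integral_le_tv_norm:
  fixes \<nu> :: "(real^'d) set \<Rightarrow> real"
  assumes nu: "\<nu> \<in> sphere_measures" and f: "continuous_on UNIV f"
    and le: "\<And>w. w \<in> usphere \<Longrightarrow> \<bar>f w\<bar> \<le> 1"
  shows "signed_integral \<nu> f \<le> tv_norm \<nu>"
    and "signed_integral \<nu> f = tv_norm \<nu> \<Longrightarrow> B \<in> sets sphere_borel \<Longrightarrow>
      (\<And>w. w \<in> B \<Longrightarrow> \<bar>f w\<bar> < 1) \<Longrightarrow> \<nu> B = 0"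
proof -
  interpret P: finite_measure "pos_part \<nu>" by (rule finite_measure_pos_part[OF nu])
  interpret N: finite_measure "neg_part \<nu>" by (rule finite_measure_neg_part[OF nu])
  note intf = integrable_pos_part[OF nu f] integrable_neg_part[OF nu f]
  note space = space_pos_part[OF nu] space_neg_part[OF nu]
  let ?a = "\<integral>w. 1 - f w \<partial>pos_part \<nu>" and ?b = "\<integral>w. 1 + f w \<partial>neg_part \<nu>"
  have eq: "?a + ?b = tv_norm \<nu> - signed_integral \<nu> f"
    using intf by (simp add: tv_norm_def signed_integral_def space)
  have nonneg: "?a \<ge> 0" "?b \<ge> 0"
    using le by (auto intro!: integral_nonneg_AE AE_I2 simp: space abs_le_iff)
     (smt (verit, best) le mem_sphere_0)+
  show "signed_integral \<nu> f \<le> tv_norm \<nu>"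
    using eq nonneg by simp
  assume "signed_integral \<nu> f = tv_norm \<nu>" and B: "B \<in> sets sphere_borel"
    and lt: "\<And>w. w \<in> B \<Longrightarrow> \<bar>f w\<bar> < 1"
  then have "?a = 0" "?b = 0"
    using eq nonneg by auto
  moreover have "AE w in pos_part \<nu>. 0 \<le> 1 - f w" "AE w in neg_part \<nu>. 0 \<le> 1 + f w"
    using le by (auto intro!: AE_I2 simp: space abs_le_iff) (smt (verit, best) le mem_sphere_0)+
  ultimately have "AE w in pos_part \<nu>. 1 - f w = 0" "AE w in neg_part \<nu>. 1 + f w = 0"
    using integral_nonneg_eq_0_iff_AE[of "pos_part \<nu>" "\<lambda>w. 1 - f w"]
      integral_nonneg_eq_0_iff_AE[of "neg_part \<nu>" "\<lambda>w. 1 + f w"] intf by auto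
  then have "AE w in pos_part \<nu>. w \<notin> B" "AE w in neg_part \<nu>. w \<notin> B"
    using lt by (auto elim!: eventually_mono) (smt (verit))+
  then have "measure (pos_part \<nu>) {w \<in> usphere. w \<in> B} = 0"
    "measure (neg_part \<nu>) {w \<in> usphere. w \<in> B} = 0"
    using emeasure_eq_0_AE[of "\<lambda>w. w \<in> B" "pos_part \<nu>"]
      emeasure_eq_0_AE[of "\<lambda>w. w \<in> B" "neg_part \<nu>"] by (auto simp: measure_def space)
  moreover have "{w \<in> usphere. w \<in> B} = B"
    using sets_sphere_borel_subset[OF B] by auto
  ultimately show "\<nu> B = 0"
    using sphere_measure_eq_diff[OF nu B] by simp
qed

section \<open>Measures concentrated on finitely many points\<close>

lemma integral_concentrated:
  fixes M :: "(real^'d) measure" and f :: "real^'d \<Rightarrow> real"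
  assumes "finite_measure M" and M: "sets M = sets sphere_borel"
    and W: "finite W" "W \<subseteq> usphere" "measure M (usphere - W) = 0"
    and f: "f \<in> borel_measurable M"
  shows "(\<integral>w. f w \<partial>M) = (\<Sum>w\<in>W. f w * measure M {w})"
proof -
  interpret finite_measure M by fact
  have space: "space M = usphere"
    using sets_eq_imp_space_eq[OF M] by simp
  have sing: "{w} \<in> sets M" if "w \<in> W" for w
    using that W M sets_sphere_borel_singleton[of w] by (auto simp: subset_iff)
  have "emeasure M (usphere - W) = 0"
    using W by (simp add: emeasure_eq_measure)
  then have "AE w in M. w \<in> W"
    using W M sets_sphere_borel_finite[OF W(1,2)] sets.top[of M]
    by (intro AE_I[of _ _ "usphere - W"]) (auto simp: space)
  then have "AE w in M. f w = (\<Sum>v\<in>W. f v * indicator {v} w)"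
    by eventually_elim (use W in \<open>auto simp: indicator_def if_distrib cong: if_cong\<close>)
  then have "(\<integral>w. f w \<partial>M) = (\<integral>w. (\<Sum>v\<in>W. f v * indicator {v} w) \<partial>M)"
    using sing by (intro integral_cong_AE f borel_measurable_sum borel_measurable_times) auto
  also have "\<dots> = (\<Sum>v\<in>W. (\<integral>w. f v * indicator {v} w \<partial>M))"
    using sing by (intro Bochner_Integration.integral_sum) (auto simp: emeasure_eq_measure)
  also have "\<dots> = (\<Sum>w\<in>W. f w * measure M {w})"
    using sing sets.sets_into_space by (intro sum.cong) auto
  finally show ?thesis .
qed

lemma sphere_measures_discrete:
  fixes w :: "'i \<Rightarrow> real^'d"
  shows "(\<lambda>A. \<Sum>i\<in>I. a i * dirac (w i) A) \<in> sphere_measures"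
proof -
  have "(\<lambda>k. \<Sum>i\<in>I. a i * dirac (w i) (A k)) sums (\<Sum>i\<in>I. a i * dirac (w i) (\<Union>k. A k))"
    if A: "range A \<subseteq> sets sphere_borel" "disjoint_family A" for A :: "nat \<Rightarrow> (real^'d) set"
  proof (intro sums_sum sums_mult)
    fix i
    have "(\<lambda>k. indicator (A k) (w i) :: real) sums indicator (\<Union>k. A k) (w i)"
      using A(2) by (intro indicator_sums) (auto simp: disjoint_family_on_def)
    moreover have "(\<Union>k. A k) \<in> sets sphere_borel"
      using A(1) by auto
    ultimately show "(\<lambda>k. dirac (w i) (A k)) sums dirac (w i) (\<Union>k. A k)"
      using A(1) by (auto simp: dirac_def image_subset_iff)
  qed
  then show ?thesis
    by (auto simp: sphere_measures_def dirac_def)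
qed

context
  fixes I :: "'i set" and w :: "'i \<Rightarrow> real^'d"
  assumes I: "finite I" "inj_on w I" "w ` I \<subseteq> usphere"
begin

lemma discrete_singleton:
  assumes "j \<in> I"
  shows "(\<Sum>i\<in>I. a i * dirac (w i) {w j}) = a j"
proof -
  have "a i * dirac (w i) {w j} = (if i = j then a j else 0)" if "i \<in> I" for i
    using that assms I sets_sphere_borel_singleton[of "w j"]
    by (auto simp: dirac_def inj_on_def indicator_def)
  then show ?thesis
    using assms I by (simp cong: sum.cong)
qed

text \<open>Injectivity of \<open>w\<close> prevents atoms of opposite sign from cancelling. The
  only Borel subsets of \<open>{w i}\<close> are the empty set and itself, so its upper variation is
  \<open>max 0 (a i)\<close>, and every set avoiding the atoms has upper variation 0.\<close>

lemma integral_pos_part_discrete: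
  fixes a f
  defines "\<nu> \<equiv> (\<lambda>A. \<Sum>i\<in>I. a i * dirac (w i) A)"
  assumes f: "continuous_on UNIV f"
  shows "(\<integral>v. f v \<partial>pos_part \<nu>) = (\<Sum>i\<in>I. f (w i) * max 0 (a i))"
proof -
  have nu: "\<nu> \<in> sphere_measures"
    unfolding \<nu>_def by (rule sphere_measures_discrete)
  interpret P: finite_measure "pos_part \<nu>" by (rule finite_measure_pos_part[OF nu])
  have meas: "usphere - w ` I \<in> sets sphere_borel"
    using I sets_sphere_borel_finite[of "w ` I"] sets.top[of "sphere_borel :: (real^'d) measure"]
    by auto
  have "emeasure (pos_part \<nu>) (usphere - w ` I) \<le> 0"
    unfolding emeasure_pos_part[OF nu meas]
  proof (rule SUP_least, clarify)
    fix B assume B: "B \<subseteq> usphere - w ` I"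
    then have "w i \<notin> B" if "i \<in> I" for i
      using that by auto
    then have "\<nu> B = 0"
      unfolding \<nu>_def by (intro sum.neutral) (auto simp: dirac_def)
    then show "ennreal (\<nu> B) \<le> 0"
      by simp
  qed
  then have 1: "measure (pos_part \<nu>) (usphere - w ` I) = 0"
    by (simp add: measure_def)
  have 2: "measure (pos_part \<nu>) {w i} = max 0 (a i)" if i: "i \<in> I" for i
  proof -
    have m: "{w i} \<in> sets sphere_borel"
      using i I sets_sphere_borel_singleton[of "w i"] by (auto simp: image_subset_iff)
    then have "{B \<in> sets sphere_borel. B \<subseteq> {w i}} = {{}, {w i}}"
      by auto
    then have "emeasure (pos_part \<nu>) {w i} = sup (ennreal (\<nu> {})) (ennreal (\<nu> {w i}))"
      by (simp add: emeasure_pos_part[OF nu m])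
    also have "\<dots> = ennreal (max 0 (a i))"
      using sphere_measure_empty[OF nu] discrete_singleton[OF i, of a]
      by (simp add: \<nu>_def ennreal_max_0 sup_absorb2)
    finally show ?thesis
      by (simp add: measure_def)
  qed
  have "(\<integral>v. f v \<partial>pos_part \<nu>) = (\<Sum>v\<in>w ` I. f v * measure (pos_part \<nu>) {v})"
    using I 1 f by (intro integral_concentrated P.finite_measure_axioms)
      (auto simp: sets_pos_part[OF nu] measurable_cong_sets[OF sets_pos_part[OF nu] refl]
        intro: borel_measurable_sphere)
  also have "\<dots> = (\<Sum>i\<in>I. f (w i) * max 0 (a i))"
    using 2 I by (simp add: sum.reindex)
  finally show ?thesis .
qed

lemma signed_integral_discrete:
  assumes "continuous_on UNIV f"
  shows "signed_integral (\<lambda>A. \<Sum>i\<in>I. a i * dirac (w i) A) f = (\<Sum>i\<in>I. a i * f (w i))"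
proof -
  have "(\<lambda>A. - (\<Sum>i\<in>I. a i * dirac (w i) A)) = (\<lambda>A. \<Sum>i\<in>I. - a i * dirac (w i) A)"
    by (simp add: sum_negf)
  then show ?thesis
    using integral_pos_part_discrete[OF assms, of a] integral_pos_part_discrete[OF assms, of "\<lambda>i. - a i"]
    by (auto simp: signed_integral_def neg_part_def sum_subtractf[symmetric] algebra_simps max_def
        intro!: sum.cong)
qed

lemma tv_norm_discrete: "tv_norm (\<lambda>A. \<Sum>i\<in>I. a i * dirac (w i) A) = (\<Sum>i\<in>I. \<bar>a i\<bar>)"
proof -
  have *: "measure (pos_part (\<lambda>A. \<Sum>i\<in>I. a i * dirac (w i) A)) usphere = (\<Sum>i\<in>I. max 0 (a i))" for a
    using integral_pos_part_discrete[of "\<lambda>_. 1" a]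
    by (simp add: space_pos_part[OF sphere_measures_discrete])
  have "(\<lambda>A. - (\<Sum>i\<in>I. a i * dirac (w i) A)) = (\<lambda>A. \<Sum>i\<in>I. - a i * dirac (w i) A)"
    by (simp add: sum_negf)
  then show ?thesis
    using *[of a] *[of "\<lambda>i. - a i"]
    by (auto simp: tv_norm_def neg_part_def sum.distrib[symmetric] max_def intro!: sum.cong)
qed

end

text \<open>The assumption concerns every Borel set without atoms rather than just the complement of
  the atoms, since a signed measure can vanish on a set and not on its subsets.\<close>

lemma sphere_measure_eq_discrete:
  fixes \<nu> :: "(real^'d) set \<Rightarrow> real"
  assumes nu: "\<nu> \<in> sphere_measures"
    and I: "finite I" "inj_on w I" "w ` I \<subseteq> usphere"
    and zero: "\<And>B. B \<in> sets sphere_borel \<Longrightarrow> B \<inter> w ` I = {} \<Longrightarrow> \<nu> B = 0"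
  shows "\<nu> = (\<lambda>A. \<Sum>i\<in>I. \<nu> {w i} * dirac (w i) A)"
proof
  fix A :: "(real^'d) set"
  show "\<nu> A = (\<Sum>i\<in>I. \<nu> {w i} * dirac (w i) A)"
  proof (cases "A \<in> sets sphere_borel")
    case False
    then show ?thesis
      using nu by (auto simp: sphere_measures_def dirac_def)
  next
    case True
    have fin: "\<nu> (w ` J) = (\<Sum>i\<in>J. \<nu> {w i})" if "finite J" "J \<subseteq> I" for J
      using that
    proof (induction J)
      case empty
      then show ?case by (simp add: sphere_measure_empty[OF nu])
    next
      case (insert j J)
      have "\<nu> ({w j} \<union> w ` J) = \<nu> {w j} + \<nu> (w ` J)"
        using insert I by (intro sphere_measure_Un[OF nu] sets_sphere_borel_singleton
            sets_sphere_borel_finite) (auto simp: inj_on_def subset_iff)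
      then show ?case
        using insert by simp
    qed
    let ?J = "{i \<in> I. w i \<in> A}"
    have J: "w ` ?J \<in> sets sphere_borel" "w ` ?J \<subseteq> A"
      using I by (auto intro!: sets_sphere_borel_finite)
    have "\<nu> A = \<nu> (A - w ` ?J) + \<nu> (w ` ?J)"
      using sphere_measure_Diff[OF nu True J] by simp
    also have "\<nu> (A - w ` ?J) = 0"
      using True J by (intro zero) auto
    also have "0 + \<nu> (w ` ?J) = (\<Sum>i\<in>?J. \<nu> {w i})"
      using fin[of ?J] I by auto
    also have "\<dots> = (\<Sum>i\<in>I. \<nu> {w i} * dirac (w i) A)"
      using I True by (intro sum.mono_neutral_cong_left) (auto simp: dirac_def)
    finally show ?thesis .
  qed
qed

section \<open>The integral operators\<close>

text \<open>For unit \<open>w\<close> this is the image under \<open>K_op x\<close> of the point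
  mass at \<open>w\<close>. It turns \<open>K_adj x p\<close> into an inner product, so that the
  dual side lives entirely in finite dimension.\<close>

definition kvec :: "('n::finite \<Rightarrow> real^'d) \<Rightarrow> real^'d \<Rightarrow> real^'n" where
  "kvec x w = (\<chi> j. relu (w \<bullet> x j))"

lemma K_adj_eq_inner: "K_adj x p w = p \<bullet> kvec x w"
  by (simp add: K_adj_def kvec_def inner_vec_def)

lemma continuous_on_kvec: "continuous_on S (kvec x)"
  unfolding kvec_def relu_def by (intro continuous_intros)

lemma continuous_on_K_adj: "continuous_on S (K_adj x p)"
  unfolding K_adj_eq_inner by (intro continuous_intros continuous_on_kvec)

lemma inner_K_op:
  assumes nu: "\<nu> \<in> sphere_measures"
  shows "p \<bullet> K_op x \<nu> = signed_integral \<nu> (K_adj x p)"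
proof -
  have c: "continuous_on UNIV (\<lambda>w. relu (w \<bullet> x j))" for j
    unfolding relu_def by (intro continuous_intros)
  note i = integrable_pos_part[OF nu c] integrable_neg_part[OF nu c]
  show ?thesis
    using i by (simp add: inner_vec_def K_op_def signed_integral_def K_adj_def
        Bochner_Integration.integral_sum algebra_simps sum_subtractf)
qed

lemma K_op_discrete:
  fixes w :: "'i \<Rightarrow> real^'d"
  assumes "finite I" "inj_on w I" "w ` I \<subseteq> usphere"
  shows "K_op x (\<lambda>A. \<Sum>i\<in>I. a i * dirac (w i) A) = (\<Sum>i\<in>I. a i *\<^sub>R kvec x (w i))"
  using signed_integral_discrete[OF assms, of "\<lambda>w. relu (w \<bullet> x _)"]
  by (simp add: vec_eq_iff K_op_def kvec_def relu_def continuous_intros)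

lemma K_op_dirac:
  assumes "w \<in> usphere"
  shows "K_op x (dirac w) = kvec x w"
  using K_op_discrete[of "{w}" id x "\<lambda>_. 1"] assms by (simp add: id_def)

lemma usphere_nonempty: "(usphere :: (real^'d) set) \<noteq> {}"
  by (simp add: sphere_empty)

text \<open>The real-valued \<open>SUP\<close> in \<open>sup_norm\<close> can be compared pointwise
  only if the set is nonempty and bounded above; compactness of the sphere supplies the
  bound.\<close>

lemma dual_feasible_iff: "dual_feasible x p \<longleftrightarrow> (\<forall>w\<in>usphere. \<bar>p \<bullet> kvec x w\<bar> \<le> 1)"
proof -
  have "compact ((\<lambda>w. \<bar>K_adj x p w\<bar>) ` usphere)"
    by (intro compact_continuous_image continuous_intros continuous_on_K_adj) simp
  then have "bdd_above ((\<lambda>w. \<bar>K_adj x p w\<bar>) ` usphere)"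
    by (intro bounded_imp_bdd_above compact_imp_bounded)
  then show ?thesis
    using usphere_nonempty
    by (simp add: dual_feasible_def sup_norm_def cSUP_le_iff K_adj_eq_inner)
qed

lemma kvec_bounds:
  fixes x :: "'n::finite \<Rightarrow> real^'d"
  shows "norm (kvec x w - kvec x v) \<le> (\<Sum>j\<in>UNIV. norm (x j)) * norm (w - v)"
    and "w \<in> usphere \<Longrightarrow> norm (kvec x w) \<le> (\<Sum>j\<in>UNIV. norm (x j))"
proof -
  show *: "norm (kvec x w - kvec x v) \<le> (\<Sum>j\<in>UNIV. norm (x j)) * norm (w - v)" for w v
  proof -
    have "norm (kvec x w - kvec x v) \<le> (\<Sum>j\<in>UNIV. \<bar>(kvec x w - kvec x v) $ j\<bar>)"
      by (rule norm_le_l1_cart)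
    also have "\<dots> \<le> (\<Sum>j\<in>UNIV. norm (x j) * norm (w - v))"
    proof (rule sum_mono)
      fix j
      have "\<bar>(kvec x w - kvec x v) $ j\<bar> \<le> \<bar>(w - v) \<bullet> x j\<bar>"
        by (auto simp: kvec_def relu_def inner_diff_left)
      also have "\<dots> \<le> norm (x j) * norm (w - v)"
        using Cauchy_Schwarz_ineq2[of "w - v" "x j"] by (simp add: mult.commute)
      finally show "\<bar>(kvec x w - kvec x v) $ j\<bar> \<le> norm (x j) * norm (w - v)" .
    qed
    finally show ?thesis
      by (simp add: sum_distrib_right)
  qed
  show "w \<in> usphere \<Longrightarrow> norm (kvec x w) \<le> (\<Sum>j\<in>UNIV. norm (x j))"
    using *[of w 0] by (simp add: kvec_def relu_def flip: zero_vec_def)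
qed

section \<open>Duality\<close>

text \<open>Used to realise an element of a convex hull of vectors \<open>\<plusminus> k w\<close>
  by a discrete measure of total variation at most 1. Requiring \<open>a w = 0\<close> off
  \<open>W\<close> lets two combinations be added over the union of their index sets.\<close>

lemma abs_combinations_convex:
  fixes k :: "'a \<Rightarrow> 'b::real_vector"
  shows "convex {\<Sum>w\<in>W. a w *\<^sub>R k w | W a. finite W \<and> W \<subseteq> S \<and> (\<forall>w. w \<notin> W \<longrightarrow> a w = 0) \<and>
    (\<Sum>w\<in>W. \<bar>a w\<bar>) \<le> (1::real)}" (is "convex ?Q")
proof (rule convexI)
  fix q q' :: 'b and u v :: real
  assume q: "q \<in> ?Q" "q' \<in> ?Q" and uv: "0 \<le> u" "0 \<le> v" "u + v = 1"
  from q(1) obtain W a where W: "q = (\<Sum>w\<in>W. a w *\<^sub>R k w)" "finite W" "W \<subseteq> S"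
    "\<forall>w. w \<notin> W \<longrightarrow> a w = 0" "(\<Sum>w\<in>W. \<bar>a w\<bar>) \<le> 1" by blast
  from q(2) obtain V b where V: "q' = (\<Sum>w\<in>V. b w *\<^sub>R k w)" "finite V" "V \<subseteq> S"
    "\<forall>w. w \<notin> V \<longrightarrow> b w = 0" "(\<Sum>w\<in>V. \<bar>b w\<bar>) \<le> 1" by blast
  have extend: "(\<Sum>w\<in>W \<union> V. a w *\<^sub>R k w) = q" "(\<Sum>w\<in>W \<union> V. b w *\<^sub>R k w) = q'"
    "(\<Sum>w\<in>W \<union> V. \<bar>a w\<bar>) = (\<Sum>w\<in>W. \<bar>a w\<bar>)" "(\<Sum>w\<in>W \<union> V. \<bar>b w\<bar>) = (\<Sum>w\<in>V. \<bar>b w\<bar>)"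
    using W V by (auto intro!: sum.mono_neutral_right)
  have "u *\<^sub>R q + v *\<^sub>R q' = (\<Sum>w\<in>W \<union> V. (u * a w + v * b w) *\<^sub>R k w)"
    unfolding extend(1,2)[symmetric]
    by (simp add: scaleR_sum_right scaleR_add_left sum.distrib)
  moreover have "(\<Sum>w\<in>W \<union> V. \<bar>u * a w + v * b w\<bar>) \<le> 1"
  proof -
    have "(\<Sum>w\<in>W \<union> V. \<bar>u * a w + v * b w\<bar>) \<le> (\<Sum>w\<in>W \<union> V. u * \<bar>a w\<bar> + v * \<bar>b w\<bar>)"
      using uv by (intro sum_mono) (metis abs_mult abs_of_nonneg abs_triangle_ineq)
    also have "\<dots> = u * (\<Sum>w\<in>W. \<bar>a w\<bar>) + v * (\<Sum>w\<in>V. \<bar>b w\<bar>)"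
      by (simp add: sum.distrib extend flip: sum_distrib_left)
    also have "\<dots> \<le> u * 1 + v * 1"
      using W V uv by (intro add_mono mult_left_mono) auto
    finally show ?thesis
      using uv by simp
  qed
  ultimately show "u *\<^sub>R q + v *\<^sub>R q' \<in> ?Q"
    using W V by (intro CollectI exI[of _ "W \<union> V"] exI[of _ "\<lambda>w. u * a w + v * b w"]) auto
qed

text \<open>Extracts a first-order optimality condition from a quadratic inequality along a ray:
  divide by \<open>t\<close> and let \<open>t\<close> tend to 0.\<close>

lemma linear_coeff_nonneg:
  fixes A B :: real
  assumes "\<And>t. 0 < t \<Longrightarrow> t \<le> 1 \<Longrightarrow> 0 \<le> t * A + t\<^sup>2 * B"
  shows "0 \<le> A"
proof (rule tendsto_lowerbound)
  show "((\<lambda>t. A + t * B) \<longlongrightarrow> A) (at_right 0)"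
    by (auto intro!: tendsto_eq_intros)
  show "\<forall>\<^sub>F t in at_right 0. 0 \<le> A + t * B"
  proof (rule eventually_at_rightI[of 0 1])
    fix t :: real assume t: "t \<in> {0<..<1}"
    then have "0 \<le> t * (A + t * B)"
      using assms[of t] by (simp add: algebra_simps power2_eq_square)
    then show "0 \<le> A + t * B"
      using t by (simp add: zero_le_mult_iff)
  qed simp
qed simp

text \<open>
  The problem is reduced to finite dimension: the values \<open>K_op x \<mu>\<close> with \<open>tv_norm \<mu> \<le> 1\<close> are
  replaced by the convex hull of the vectors \<open>\<plusminus> kvec x w\<close>, which is compact, so that
  the minimum over its multiples is attained; the dual vector is read off the first-order
  conditions.
\<close>
lemma primal_dual_pair:
  fixes x :: "'n::finite \<Rightarrow> real^'d" and y :: "real^'n"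
  assumes l: "l > 0"
  obtains p \<mu> where "dual_feasible x p" "\<mu> \<in> sphere_measures" "K_op x \<mu> = y - l *\<^sub>R p"
    "tv_norm \<mu> \<le> p \<bullet> K_op x \<mu>"
proof -
  \<comment> \<open>\<open>G\<close> is symmetric, so its hull \<open>H\<close> plays the role of a
    unit ball: in \<open>c *\<^sub>R u\<close> with \<open>u \<in> H\<close>, the scalar
    \<open>c\<close> stands for the total variation.\<close>
  define G where "G = kvec x ` usphere \<union> uminus ` kvec x ` (usphere :: (real^'d) set)"
  define H where "H = convex hull G"
  have "compact G"
    unfolding G_def by (intro compact_Un compact_continuous_image continuous_on_kvec
        continuous_intros) auto
  then have H: "compact H" "convex H"
    by (auto simp: H_def compact_convex_hull)
  have HG: "kvec x w \<in> H" "- kvec x w \<in> H" if "w \<in> usphere" for w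
    using that by (auto simp: H_def G_def intro!: hull_inc)
  have "H \<noteq> {}"
    using HG(1) usphere_nonempty by blast
  define F where "F = (\<lambda>(c, u). 1/2 * (norm (c *\<^sub>R u - y))\<^sup>2 + l * c)"
  \<comment> \<open>\<open>l * cm\<close> is the value of the objective at \<open>c = 0\<close>, so
    any larger \<open>c\<close> costs more than the zero measure through the regulariser alone. This
    restricts the minimisation to a compact set.\<close>
  define cm where "cm = (norm y)\<^sup>2 / (2 * l)"
  have cm: "cm \<ge> 0" "l * cm = (norm y)\<^sup>2 / 2"
    using l by (auto simp: cm_def)
  have "compact ({0..cm} \<times> H)" "{0..cm} \<times> H \<noteq> {}" "continuous_on ({0..cm} \<times> H) F"
    using H cm \<open>H \<noteq> {}\<close> unfolding F_def case_prod_unfold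
    by (auto intro!: compact_Times continuous_intros)
  then obtain z where z: "z \<in> {0..cm} \<times> H" "\<And>z'. z' \<in> {0..cm} \<times> H \<Longrightarrow> F z \<le> F z'"
    using continuous_attains_inf by metis
  obtain c u where cu: "z = (c, u)" "0 \<le> c" "u \<in> H"
    using z by auto
  have min: "F (c, u) \<le> F (c', u')" if "c' \<ge> 0" "u' \<in> H" for c' u'
  proof (cases "c' \<le> cm")
    case True
    then show ?thesis
      using z that cu by auto
  next
    case False
    have "F (c, u) \<le> F (0, u')"
      using z that cu cm by auto
    also have "\<dots> = l * cm"
      by (simp add: F_def cm)
    also have "\<dots> \<le> l * c'"
      using l False by simp
    also have "\<dots> \<le> F (c', u')"
      by (simp add: F_def)
    finally show ?thesis .
  qed
  define v where "v = c *\<^sub>R u"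
  \<comment> \<open>The dual vector is the scaled residual, so the relation
    \<open>K_op x \<mu> = y - l *\<^sub>R p\<close> holds as soon as \<mu> realises
    \<open>v\<close>.\<close>
  define p where "p = (y - v) /\<^sub>R l"
  have yv: "y - v = l *\<^sub>R p"
    using l by (simp add: p_def)
  have expand: "1/2 * (norm (v + t *\<^sub>R g - y))\<^sup>2 = 1/2 * (norm (v - y))\<^sup>2 - t * (l * (p \<bullet> g)) + t\<^sup>2 * ((norm g)\<^sup>2 / 2)"
    for t g
  proof -
    have eqs: "v + t *\<^sub>R g - y = t *\<^sub>R g - l *\<^sub>R p" "v - y = - (l *\<^sub>R p)"
      using yv by (auto simp: algebra_simps)
    show ?thesis
      unfolding eqs power2_norm_eq_inner
      by (simp add: algebra_simps inner_commute power2_eq_square)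
  qed
  \<comment> \<open>Feasibility comes from moving \<open>v\<close> in the direction
    \<open>g\<close>: the point \<open>v + t *\<^sub>R g\<close> is \<open>c + t\<close> times a
    convex combination of \<open>u\<close> and \<open>g\<close>, so the regulariser grows by at most
    \<open>l * t\<close>.\<close>
  have pg: "p \<bullet> g \<le> 1" if g: "g \<in> H" for g
  proof -
    have "0 \<le> l * (1 - p \<bullet> g)"
    proof (rule linear_coeff_nonneg)
      fix t :: real assume t: "0 < t" "t \<le> 1"
      have "v + t *\<^sub>R g = (c + t) *\<^sub>R ((c / (c + t)) *\<^sub>R u + (t / (c + t)) *\<^sub>R g)"
        using t cu by (simp add: v_def scaleR_add_right)
      moreover have "(c / (c + t)) *\<^sub>R u + (t / (c + t)) *\<^sub>R g \<in> H"
        using t cu g by (intro convexD[OF H(2)]) (auto simp: add_divide_distrib[symmetric])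
      ultimately have "1/2 * (norm (v - y))\<^sup>2 + l * c \<le> 1/2 * (norm (v + t *\<^sub>R g - y))\<^sup>2 + l * (c + t)"
        using min[of "c + t" "(c / (c + t)) *\<^sub>R u + (t / (c + t)) *\<^sub>R g"] t cu
        by (simp add: F_def v_def)
      then show "0 \<le> t * (l * (1 - p \<bullet> g)) + t\<^sup>2 * ((norm g)\<^sup>2 / 2)"
        unfolding expand by (simp add: algebra_simps)
    qed
    then show ?thesis
      using l by (simp add: zero_le_mult_iff)
  qed
  \<comment> \<open>Here the variation is a shrinking of \<open>v\<close> towards 0, which lowers
    the regulariser by \<open>t * l * c\<close>.\<close>
  have "c \<le> p \<bullet> v"
  proof -
    have "0 \<le> l * (p \<bullet> v - c)"
    proof (rule linear_coeff_nonneg)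
      fix t :: real assume t: "0 < t" "t \<le> 1"
      have "v + (- t) *\<^sub>R v = ((1 - t) * c) *\<^sub>R u"
        by (simp add: v_def algebra_simps)
      then have "1/2 * (norm (v - y))\<^sup>2 + l * c \<le> 1/2 * (norm (v + (- t) *\<^sub>R v - y))\<^sup>2 + l * ((1 - t) * c)"
        using min[of "(1 - t) * c" u] t cu by (simp add: F_def v_def)
      then show "0 \<le> t * (l * (p \<bullet> v - c)) + t\<^sup>2 * ((norm v)\<^sup>2 / 2)"
        unfolding expand by (simp add: algebra_simps)
    qed
    then show ?thesis
      using l by (simp add: zero_le_mult_iff)
  qed
  have feasible: "dual_feasible x p"
    unfolding dual_feasible_iff using pg HG by (fastforce simp: abs_le_iff)
  have "H \<subseteq> {\<Sum>w\<in>W. a w *\<^sub>R kvec x w | W a. finite W \<and> W \<subseteq> usphere \<and> (\<forall>w. w \<notin> W \<longrightarrow> a w = 0) \<and>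
    (\<Sum>w\<in>W. \<bar>a w\<bar>) \<le> (1::real)}" (is "_ \<subseteq> ?Q")
    unfolding H_def
  proof (rule hull_minimal)
    show "convex ?Q"
      by (rule abs_combinations_convex)
    have "s *\<^sub>R kvec x w \<in> ?Q" if "w \<in> usphere" "\<bar>s\<bar> = 1" for s w
      using that by (intro CollectI exI[of _ "{w}"] exI[of _ "\<lambda>v. if v = w then s else 0"]) auto
    from this[of _ 1] this[of _ "-1"] show "G \<subseteq> ?Q"
      unfolding G_def by auto
  qed
  then obtain W a where W: "u = (\<Sum>w\<in>W. a w *\<^sub>R kvec x w)" "finite W" "W \<subseteq> usphere"
    "(\<Sum>w\<in>W. \<bar>a w\<bar>) \<le> 1"
    using cu by blast
  define \<mu> where "\<mu> = (\<lambda>A. \<Sum>w\<in>W. (c * a w) * dirac w A)"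
  have K: "K_op x \<mu> = v"
    unfolding \<mu>_def using K_op_discrete[of W "\<lambda>w. w" x "\<lambda>w. c * a w"] W
    by (simp add: v_def scaleR_sum_right)
  have "tv_norm \<mu> = c * (\<Sum>w\<in>W. \<bar>a w\<bar>)"
    unfolding \<mu>_def using tv_norm_discrete[of W "\<lambda>w. w" "\<lambda>w. c * a w"] W cu
    by (simp add: abs_mult sum_distrib_left)
  also have "\<dots> \<le> c"
    using W cu by (simp add: mult_left_le)
  also have "\<dots> \<le> p \<bullet> K_op x \<mu>"
    using \<open>c \<le> p \<bullet> v\<close> K by simp
  finally have "tv_norm \<mu> \<le> p \<bullet> K_op x \<mu>" .
  moreover have "\<mu> \<in> sphere_measures"
    unfolding \<mu>_def by (rule sphere_measures_discrete)
  moreover have "K_op x \<mu> = y - l *\<^sub>R p"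
    using K yv by (simp add: algebra_simps)
  ultimately show thesis
    using that feasible by blast
qed

lemma inner_K_op_le_tv_norm:
  assumes "dual_feasible x p" "\<mu> \<in> sphere_measures"
  shows "p \<bullet> K_op x \<mu> \<le> tv_norm \<mu>"
  unfolding inner_K_op[OF assms(2)]
  using assms by (intro signed_integral_le_tv_norm continuous_on_K_adj)
    (auto simp: dual_feasible_iff K_adj_eq_inner)

text \<open>Read with \<open>v = K_op x \<mu>\<close> and \<open>c = tv_norm \<mu>\<close>: the left
  side is the primal value minus \<open>l\<close> times the dual value. On the right both terms are
  nonnegative for feasible \<open>p\<close>, so a zero gap yields the two optimality conditions at
  once.\<close>

lemma duality_gap:
  fixes y v p :: "'a::real_inner"
  shows "1/2 * (norm (v - y))\<^sup>2 + l * c - l * (y \<bullet> p - l/2 * (norm p)\<^sup>2)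
    = 1/2 * (norm (v - y + l *\<^sub>R p))\<^sup>2 + l * (c - p \<bullet> v)"
  unfolding power2_norm_eq_inner
  by (simp add: algebra_simps inner_commute power2_eq_square)

text \<open>The pair from \<open>primal_dual_pair\<close> has zero gap, so each member is optimal.
  Every other solution of either problem then has zero gap with its partner from that pair and
  inherits the optimality conditions.\<close>

lemma training_solutions:
  fixes x :: "'n::finite \<Rightarrow> real^'d" and y :: "real^'n"
  assumes l: "l > 0"
  defines "p \<equiv> training_dual_solution x l y"
  shows "dual_feasible x p"
    and "dual_feasible x q \<Longrightarrow> y \<bullet> q - l/2 * (norm q)\<^sup>2 \<le> y \<bullet> p - l/2 * (norm p)\<^sup>2"
    and "\<exists>\<mu>. training_solution x l y \<mu>"
    and "training_solution x l y \<mu> \<Longrightarrow>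
      \<mu> \<in> sphere_measures \<and> K_op x \<mu> = y - l *\<^sub>R p \<and> signed_integral \<mu> (K_adj x p) = tv_norm \<mu>"
proof -
  obtain p' \<mu>' where p': "dual_feasible x p'" and mu': "\<mu>' \<in> sphere_measures"
    "K_op x \<mu>' = y - l *\<^sub>R p'" "tv_norm \<mu>' \<le> p' \<bullet> K_op x \<mu>'"
    using primal_dual_pair[OF l] by blast
  let ?J = "\<lambda>\<mu>. 1/2 * (norm (K_op x \<mu> - y))\<^sup>2 + l * tv_norm \<mu>"
  let ?D = "\<lambda>p. y \<bullet> p - l/2 * (norm p)\<^sup>2"
  have gap: "?J \<mu> - l * ?D q = 1/2 * (norm (K_op x \<mu> - y + l *\<^sub>R q))\<^sup>2 + l * (tv_norm \<mu> - q \<bullet> K_op x \<mu>)"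
    for \<mu> q by (rule duality_gap)
  have gap_nonneg: "l * (tv_norm \<mu> - q \<bullet> K_op x \<mu>) \<ge> 0"
    if "dual_feasible x q" "\<mu> \<in> sphere_measures" for \<mu> q
    using inner_K_op_le_tv_norm[OF that] l by simp
  have weak: "l * ?D q \<le> ?J \<mu>" if "dual_feasible x q" "\<mu> \<in> sphere_measures" for \<mu> q
    using gap[of \<mu> q] gap_nonneg[OF that] zero_le_power2[of "norm (K_op x \<mu> - y + l *\<^sub>R q)"] by linarith
  have tight: "K_op x \<mu> = y - l *\<^sub>R q \<and> q \<bullet> K_op x \<mu> = tv_norm \<mu>"
    if "dual_feasible x q" "\<mu> \<in> sphere_measures" "?J \<mu> \<le> l * ?D q" for \<mu> q
  proof -
    have "(norm (K_op x \<mu> - y + l *\<^sub>R q))\<^sup>2 = 0 \<and> l * (tv_norm \<mu> - q \<bullet> K_op x \<mu>) = 0"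
      using gap[of \<mu> q] gap_nonneg[OF that(1,2)] that(3)
        zero_le_power2[of "norm (K_op x \<mu> - y + l *\<^sub>R q)"] by linarith
    then show ?thesis
      using l by (auto simp: add_eq_0_iff2 algebra_simps eq_diff_eq)
  qed
  have strong: "?J \<mu>' = l * ?D p'"
  proof -
    have "K_op x \<mu>' - y + l *\<^sub>R p' = 0" "tv_norm \<mu>' - p' \<bullet> K_op x \<mu>' = 0"
      using mu' inner_K_op_le_tv_norm[OF p' mu'(1)] by simp_all
    then show ?thesis
      using gap[of \<mu>' p'] by (simp only:) simp
  qed
  have max: "?D q \<le> ?D p'" if "dual_feasible x q" for q
    using weak[OF that mu'(1)] strong l by simp
  have "training_dual_solution x l y = p'"
    unfolding training_dual_solution_def
  proof (rule the_equality)
    show "is_arg_max ?D (dual_feasible x) p'"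
      using p' max by (auto simp: is_arg_max_def not_less)
  next
    fix q assume q: "is_arg_max ?D (dual_feasible x) q"
    then have "?D p' \<le> ?D q" "dual_feasible x q"
      using p' by (auto simp: is_arg_max_def not_less)
    \<comment> \<open>Every dual maximiser is tight against the same \<mu>', which determines it as
      the scaled residual; this justifies the \<open>THE\<close> in
      \<open>training_dual_solution\<close>.\<close>
    then have "K_op x \<mu>' = y - l *\<^sub>R q"
      using tight[of q \<mu>'] mu' strong l by simp
    then show "q = p'"
      using mu' l by simp
  qed
  then have p: "p = p'"
    by (simp add: p_def)
  show "dual_feasible x p" "dual_feasible x q \<Longrightarrow> ?D q \<le> ?D p"
    using p' max p by auto
  have sol: "training_solution x l y \<mu>'"
    unfolding training_solution_def is_arg_min_def
    using mu' weak[OF p'] strong by (force simp: not_less)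
  then show "\<exists>\<mu>. training_solution x l y \<mu>"
    by blast
  assume "training_solution x l y \<mu>"
  then have mu: "\<mu> \<in> sphere_measures" "?J \<mu> \<le> ?J \<mu>'"
    using mu' by (auto simp: training_solution_def is_arg_min_def not_less)
  then show "\<mu> \<in> sphere_measures \<and> K_op x \<mu> = y - l *\<^sub>R p \<and> signed_integral \<mu> (K_adj x p) = tv_norm \<mu>"
    using tight[OF p' mu(1)] strong inner_K_op[OF mu(1), of p' x] p by simp
qed

section \<open>Strata\<close>

lemma subspace_L_space: "subspace (L_space x J)"
  unfolding L_space_def hyperplane_def
  by (intro subspace_Inter) (auto simp: subspace_def inner_add_left)

text \<open>The difference of two candidates lies in \<open>L\<close> and is orthogonal to
  \<open>L\<close>, hence to itself.\<close>

lemma orth_proj_eqI: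
  assumes "subspace L" "u \<in> L" "\<And>z. z \<in> L \<Longrightarrow> (v - u) \<bullet> z = 0"
  shows "orth_proj L v = u"
  unfolding orth_proj_def
proof (rule the_equality)
  show "u \<in> L \<and> (\<forall>z\<in>L. orthogonal (v - u) z)"
    using assms by (auto simp: orthogonal_def)
next
  fix u' assume u': "u' \<in> L \<and> (\<forall>z\<in>L. orthogonal (v - u') z)"
  then have "u' - u \<in> L"
    using assms by (intro subspace_diff) auto
  then have "(v - u) \<bullet> (u' - u) = 0" "(v - u') \<bullet> (u' - u) = 0"
    using assms u' by (auto simp: orthogonal_def)
  then have "(u' - u) \<bullet> (u' - u) = 0"
    by (simp add: inner_diff_left)
  then show "u' = u"
    by simp
qed

lemma stratum_iff:
  "w \<in> stratum x \<pi> J \<longleftrightarrow>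
    (\<forall>j. if j \<in> J then if \<pi> j then w \<bullet> x j > 0 else w \<bullet> x j < 0 else w \<bullet> x j = 0)"
proof -
  have "w \<in> half_space x j b \<longleftrightarrow> (if b then w \<bullet> x j > 0 else w \<bullet> x j < 0)" for j b
    by (simp add: half_space_def)
  then show ?thesis
    unfolding stratum_def Int_iff INT_iff hyperplane_def by auto
qed

lemma kvec_scaleR: "t \<ge> 0 \<Longrightarrow> kvec x (t *\<^sub>R u) = t *\<^sub>R kvec x u"
  by (simp add: vec_eq_iff kvec_def relu_def max_mult_distrib_left)

lemma mem_stratum_self: "w \<in> stratum x (\<lambda>j. w \<bullet> x j > 0) {j. w \<bullet> x j \<noteq> 0}"
  by (auto simp: stratum_iff)

lemma stratum_subset_L_space: "stratum x \<pi> J \<subseteq> L_space x J"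
  by (auto simp: stratum_def L_space_def)

lemma convex_stratum: "convex (stratum x \<pi> J)"
  unfolding stratum_def half_space_def hyperplane_def
  by (intro convex_Int convex_INT)
    (auto simp: convex_halfspace_gt convex_halfspace_lt convex_hyperplane inner_commute[of _ "x _"])

text \<open>The signs of all \<open>w \<bullet> x j\<close> are constant on a stratum, so each ReLU
  acts there as the identity or as 0. The vector on the right, projected onto
  \<open>L_space x J\<close>, is \<open>z_tilde x p J \<pi>\<close>.\<close>

lemma inner_kvec_stratum:
  assumes "w \<in> stratum x \<pi> J"
  shows "p \<bullet> kvec x w = (\<Sum>j\<in>J. (p $ j * of_bool (\<pi> j)) *\<^sub>R x j) \<bullet> w"
proof -
  have "p \<bullet> kvec x w = (\<Sum>j\<in>UNIV. p $ j * relu (w \<bullet> x j))"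
    by (simp add: kvec_def inner_vec_def)
  also have "\<dots> = (\<Sum>j\<in>J. p $ j * of_bool (\<pi> j) * (x j \<bullet> w))"
    using assms by (intro sum.mono_neutral_cong_right)
      (auto simp: stratum_iff relu_def inner_commute max_def not_le dest!: spec split: if_splits)
  finally show ?thesis
    by (simp add: inner_sum_left)
qed

text \<open>
  At a saturated point \<open>w\<close> of a stratum, the restriction of \<open>s * K_adj x p\<close> to \<open>L_space x J\<close> is
  linear near \<open>w\<close> and bounded by the norm, with equality at \<open>w\<close>.
\<close>
lemma saturated_orthogonal:
  fixes x :: "'n::finite \<Rightarrow> real^'d"
  assumes p: "dual_feasible x p" and w: "w \<in> usphere" "w \<in> stratum x \<pi> J"
    and s: "\<bar>s\<bar> = 1" and sat: "p \<bullet> kvec x w = s" and z: "z \<in> L_space x J"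
  shows "((\<Sum>j\<in>J. (p $ j * of_bool (\<pi> j)) *\<^sub>R x j) - s *\<^sub>R w) \<bullet> z = 0"
proof -
  define v where "v = (\<Sum>j\<in>J. (p $ j * of_bool (\<pi> j)) *\<^sub>R x j)"
  have ss: "s * s = 1"
    using s by (metis abs_mult_self_eq mult_1)
  have ww: "w \<bullet> w = 1"
    using w by (simp add: dot_square_norm)
  \<comment> \<open>Positive homogeneity extends the bound on the sphere to the whole space.\<close>
  have bound: "\<bar>p \<bullet> kvec x u\<bar> \<le> norm u" for u
  proof (cases "u = 0")
    case True
    then show ?thesis by (simp add: kvec_def relu_def flip: zero_vec_def)
  next
    case False
    have "kvec x u = norm u *\<^sub>R kvec x (u /\<^sub>R norm u)"
      using False kvec_scaleR[of "norm u" x "u /\<^sub>R norm u"] by simp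
    moreover have "\<bar>p \<bullet> kvec x (u /\<^sub>R norm u)\<bar> \<le> 1"
      using p False by (auto simp: dual_feasible_iff)
    ultimately show ?thesis
      by (simp add: abs_mult mult_left_le)
  qed
  have ev: "\<forall>\<^sub>F t in at_right 0. w + t *\<^sub>R y \<in> stratum x \<pi> J" if y: "y \<in> L_space x J" for y
  proof -
    have "\<forall>\<^sub>F t in at_right 0. w + t *\<^sub>R y \<in> half_space x j (\<pi> j)" if "j \<in> J" for j
    proof -
      have lim: "((\<lambda>t. (w + t *\<^sub>R y) \<bullet> x j) \<longlongrightarrow> w \<bullet> x j) (at_right 0)"
        by (auto intro!: tendsto_eq_intros)
      have "w \<in> half_space x j (\<pi> j)"
        using w that by (auto simp: stratum_def)
      then show ?thesis
        using order_tendstoD[OF lim] by (auto simp: half_space_def split: if_splits)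
    qed
    then have "\<forall>\<^sub>F t in at_right 0. \<forall>j\<in>J. w + t *\<^sub>R y \<in> half_space x j (\<pi> j)"
      by (intro eventually_ball_finite) auto
    then show ?thesis
      by eventually_elim
        (use w y in \<open>auto simp: stratum_def L_space_def hyperplane_def inner_add_left\<close>)
  qed
  \<comment> \<open>Along \<open>w + t *\<^sub>R y\<close> the certificate is affine in
    \<open>t\<close> and dominated by the norm. Squaring this comparison cancels the constant terms,
    since \<open>s * s = 1\<close> and \<open>w \<bullet> w = 1\<close>; dividing by
    \<open>t\<close> leaves the first-order inequality. Applied to \<open>z\<close> and
    \<open>- z\<close> it becomes an equality.\<close>
  have key: "0 \<le> w \<bullet> y - s * (v \<bullet> y)" if y: "y \<in> L_space x J" for y
  proof -
    have "\<forall>\<^sub>F t in at_right 0. 0 \<le> 2 * (w \<bullet> y - s * (v \<bullet> y)) + t * (y \<bullet> y - (v \<bullet> y)\<^sup>2)"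
      using ev[OF y] eventually_at_right_less[of 0]
    proof eventually_elim
      case (elim t)
      have "p \<bullet> kvec x (w + t *\<^sub>R y) = s + t * (v \<bullet> y)"
        using inner_kvec_stratum[OF elim(1), of p] inner_kvec_stratum[OF w(2), of p] sat
        by (simp add: inner_add_right v_def)
      then have "(s + t * (v \<bullet> y))\<^sup>2 \<le> (norm (w + t *\<^sub>R y))\<^sup>2"
        using bound[of "w + t *\<^sub>R y"] by (metis abs_ge_zero power2_abs power_mono)
      then have "0 \<le> t * (2 * (w \<bullet> y - s * (v \<bullet> y)) + t * (y \<bullet> y - (v \<bullet> y)\<^sup>2))"
        unfolding power2_norm_eq_inner using ss ww
        by (simp add: algebra_simps power2_eq_square inner_commute)
      then show ?case
        using elim(2) by (simp add: zero_le_mult_iff)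
    qed
    moreover have "((\<lambda>t. 2 * (w \<bullet> y - s * (v \<bullet> y)) + t * (y \<bullet> y - (v \<bullet> y)\<^sup>2))
        \<longlongrightarrow> 2 * (w \<bullet> y - s * (v \<bullet> y))) (at_right 0)"
      by (auto intro!: tendsto_eq_intros)
    ultimately show ?thesis
      using tendsto_lowerbound by fastforce
  qed
  have "- z \<in> L_space x J"
    using z by (intro subspace_neg subspace_L_space)
  from key[OF z] key[OF this] have "s * (v \<bullet> z) = w \<bullet> z"
    by simp
  then have "v \<bullet> z = s * (w \<bullet> z)"
    using ss by (metis mult.assoc mult_1)
  then show ?thesis
    by (simp add: v_def inner_diff_left)
qed

lemma saturated_unique_in_stratum:
  assumes p: "dual_feasible x p" and w: "w \<in> usphere" "w \<in> stratum x \<pi> J" "p \<bullet> kvec x w = s"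
    and w': "w' \<in> usphere" "w' \<in> stratum x \<pi> J" "p \<bullet> kvec x w' = s" and s: "\<bar>s\<bar> = 1"
  shows "w = w'"
proof (rule ccontr)
  assume "w \<noteq> w'"
  define m where "m = (1/2) *\<^sub>R w + (1/2) *\<^sub>R w'"
  have "m \<in> stratum x \<pi> J"
    unfolding m_def using w w' by (intro convexD[OF convex_stratum]) auto
  then have m: "p \<bullet> kvec x m = s"
    using inner_kvec_stratum[of _ x \<pi> J p] w w' by (simp add: m_def inner_add_right)
  have "m \<noteq> 0"
    using m s by (auto simp: kvec_def relu_def simp flip: zero_vec_def)
  have "(norm m)\<^sup>2 = 1 - (norm (w - w'))\<^sup>2 / 4"
    using w w' unfolding m_def power2_norm_eq_inner
    by (simp add: algebra_simps inner_commute) (simp add: dot_square_norm field_simps)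
  moreover have "(norm (w - w'))\<^sup>2 > 0"
    using \<open>w \<noteq> w'\<close> by simp
  ultimately have "(norm m)\<^sup>2 < 1\<^sup>2"
    by simp
  then have lt: "norm m < 1"
    by (rule power2_less_imp_less) simp
  \<comment> \<open>Rescaling the midpoint to the sphere divides its value \<open>s\<close> by a
    norm below 1, which violates feasibility.\<close>
  have "kvec x (m /\<^sub>R norm m) = kvec x m /\<^sub>R norm m"
    by (rule kvec_scaleR) simp
  then have "\<bar>s\<bar> / norm m \<le> 1"
    using p \<open>m \<noteq> 0\<close> m by (auto simp: dual_feasible_iff divide_inverse_commute abs_mult
        dest!: bspec[of _ _ "m /\<^sub>R norm m"])
  then show False
    using lt s \<open>m \<noteq> 0\<close> by (simp add: divide_le_eq)
qed

text \<open>
  The first-order condition of \<open>saturated_orthogonal\<close> is closed in \<open>(p, w)\<close>, so a stratum that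
  contains saturated points for parameters arbitrarily close to \<open>(p0, w0)\<close> satisfies it at
  \<open>(p0, w0)\<close>, i.e. its \<open>z_tilde\<close> is \<open>s *\<^sub>R w0\<close>; by nondegeneracy there is only one such stratum.
\<close>
lemma saturated_locally_unique:
  fixes x :: "'n::finite \<Rightarrow> real^'d" and p0 :: "real^'n"
  assumes w0: "w0 \<in> usphere" and s: "\<bar>s\<bar> = 1"
    and ND: "\<And>\<pi> J \<pi>1 J1 \<pi>2 J2.
        J \<subset> UNIV \<Longrightarrow> w0 \<in> stratum x \<pi> J \<Longrightarrow>
        stratum x \<pi>1 J1 \<in> compatible_strata x \<pi> J \<Longrightarrow>
        stratum x \<pi>2 J2 \<in> compatible_strata x \<pi> J \<Longrightarrow>
        stratum x \<pi>1 J1 \<noteq> stratum x \<pi>2 J2 \<Longrightarrow>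
        z_tilde x p0 J1 \<pi>1 \<noteq> 0 \<Longrightarrow> z_tilde x p0 J2 \<pi>2 \<noteq> 0 \<Longrightarrow>
        z_tilde x p0 J1 \<pi>1 /\<^sub>R norm (z_tilde x p0 J1 \<pi>1)
          \<noteq> z_tilde x p0 J2 \<pi>2 /\<^sub>R norm (z_tilde x p0 J2 \<pi>2)"
  shows "\<exists>r>0. \<forall>p w w'. dual_feasible x p \<longrightarrow> dist p p0 < r \<longrightarrow> w \<in> usphere \<longrightarrow> w' \<in> usphere \<longrightarrow>
    dist w w0 < r \<longrightarrow> dist w' w0 < r \<longrightarrow> p \<bullet> kvec x w = s \<longrightarrow> p \<bullet> kvec x w' = s \<longrightarrow> w = w'"
proof -
  define vec where "vec = (\<lambda>p \<pi> J. \<Sum>j\<in>J. ((p::real^'n) $ j * of_bool (\<pi> j)) *\<^sub>R x j)"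
  \<comment> \<open>Membership of \<open>w\<close> is asked in \<open>L_space x J\<close> and not in
    the stratum, which is not closed: the limit \<open>w0\<close> may belong to a smaller
    stratum.\<close>
  define crit where "crit = (\<lambda>\<pi> J. {(p, w). w \<in> L_space x J \<and>
      (\<forall>z\<in>L_space x J. (vec p \<pi> J - s *\<^sub>R w) \<bullet> z = 0)})"
  have "closed (crit \<pi> J)" for \<pi> J
  proof -
    have "crit \<pi> J = UNIV \<times> L_space x J \<inter> (\<Inter>z\<in>L_space x J. {q. (vec (fst q) \<pi> J - s *\<^sub>R snd q) \<bullet> z = 0})"
      by (auto simp: crit_def)
    moreover have "closed {q. (vec (fst q) \<pi> J - s *\<^sub>R snd q) \<bullet> z = 0}" for z
      unfolding vec_def by (intro closed_Collect_eq continuous_intros)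
    moreover have "closed (L_space x J)"
      by (intro closed_subspace subspace_L_space)
    ultimately show ?thesis
      by (simp add: closed_Int closed_Times closed_INT)
  qed
  then have "\<forall>\<^sub>F q in nhds (p0, w0). q \<in> crit \<pi> J \<longrightarrow> (p0, w0) \<in> crit \<pi> J" for \<pi> J
    using eventually_nhds_in_open[of "- crit \<pi> J" "(p0, w0)"]
    by (cases "(p0, w0) \<in> crit \<pi> J") (auto elim!: eventually_mono)
  \<comment> \<open>There are finitely many pairs of \<pi> and \<open>J\<close>, so a single
    neighbourhood serves all of them.\<close>
  then have ev1: "\<forall>\<^sub>F q in nhds (p0, w0). \<forall>\<pi> J. q \<in> crit \<pi> J \<longrightarrow> (p0, w0) \<in> crit \<pi> J"
    by (intro eventually_all_finite)
  \<comment> \<open>Nonzero signs at \<open>w0\<close> persist nearby; only zero entries can become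
    nonzero. This places the stratum of a nearby point in the compatible family of the stratum of
    \<open>w0\<close>.\<close>
  have ev2: "\<forall>\<^sub>F q in nhds (p0, w0). \<forall>j. w0 \<bullet> x j \<noteq> 0 \<longrightarrow>
      snd q \<bullet> x j \<noteq> 0 \<and> (snd q \<bullet> x j > 0 \<longleftrightarrow> w0 \<bullet> x j > 0)"
  proof (intro eventually_all_finite)
    fix j
    have lim: "((\<lambda>q. snd q \<bullet> x j) \<longlongrightarrow> snd (p0, w0) \<bullet> x j) (nhds (p0, w0))"
      by (intro tendsto_intros filterlim_ident)
    consider "w0 \<bullet> x j = 0" | "w0 \<bullet> x j > 0" | "w0 \<bullet> x j < 0" by linarith
    then show "\<forall>\<^sub>F q in nhds (p0, w0). w0 \<bullet> x j \<noteq> 0 \<longrightarrow>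
      snd q \<bullet> x j \<noteq> 0 \<and> (snd q \<bullet> x j > 0 \<longleftrightarrow> w0 \<bullet> x j > 0)"
    proof cases
      case 2
      then have "\<forall>\<^sub>F q in nhds (p0, w0). snd q \<bullet> x j > 0"
        using order_tendstoD(1)[OF lim, of 0] by simp
      then show ?thesis
        by eventually_elim (use 2 in auto)
    next
      case 3
      then have "\<forall>\<^sub>F q in nhds (p0, w0). snd q \<bullet> x j < 0"
        using order_tendstoD(2)[OF lim, of 0] by simp
      then show ?thesis
        by eventually_elim (use 3 in auto)
    qed simp
  qed
  obtain e where e: "e > 0" "\<And>q. dist q (p0, w0) < e \<Longrightarrow>
      (\<forall>\<pi> J. q \<in> crit \<pi> J \<longrightarrow> (p0, w0) \<in> crit \<pi> J) \<and>
      (\<forall>j. w0 \<bullet> x j \<noteq> 0 \<longrightarrow> snd q \<bullet> x j \<noteq> 0 \<and> (snd q \<bullet> x j > 0 \<longleftrightarrow> w0 \<bullet> x j > 0))"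
    using eventually_conj[OF ev1 ev2] unfolding eventually_nhds_metric by blast
  define J0 where "J0 = {j. w0 \<bullet> x j \<noteq> 0}"
  define \<pi>0 where "\<pi>0 = (\<lambda>j. w0 \<bullet> x j > 0)"
  have near: "stratum x \<pi> J \<in> compatible_strata x \<pi>0 J0 \<and> z_tilde x p0 J \<pi> = s *\<^sub>R w0"
    if "dual_feasible x p" "dist p p0 < e / 2" "w \<in> usphere" "dist w w0 < e / 2"
      "p \<bullet> kvec x w = s" "J = {j. w \<bullet> x j \<noteq> 0}" "\<pi> = (\<lambda>j. w \<bullet> x j > 0)" for p w \<pi> J
  proof -
    have mem: "w \<in> stratum x \<pi> J"
      using mem_stratum_self[of w x] that by simp
    then have "(p, w) \<in> crit \<pi> J"
      using saturated_orthogonal[OF that(1,3) mem s that(5)] subsetD[OF stratum_subset_L_space mem]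
      by (auto simp: crit_def vec_def)
    moreover have "dist (p, w) (p0, w0) \<le> dist p p0 + dist w w0"
      by (simp add: dist_Pair_Pair sqrt_sum_squares_le_sum)
    then have "dist (p, w) (p0, w0) < e"
      using that by linarith
    note near = e(2)[OF this]
    ultimately have "(p0, w0) \<in> crit \<pi> J"
      by blast
    then have "z_tilde x p0 J \<pi> = s *\<^sub>R w0"
      unfolding z_tilde_def
      by (intro orth_proj_eqI subspace_L_space) (auto simp: crit_def vec_def intro: subspace_scale subspace_L_space)
    moreover have "J0 \<subseteq> J \<and> (\<forall>j\<in>J0. \<pi> j = \<pi>0 j)"
      using near that by (auto simp: J0_def \<pi>0_def)
    ultimately show ?thesis
      using mem by (auto simp: compatible_strata_def)
  qed
  show ?thesis
  proof (intro exI[of _ "e / 2"] conjI allI impI)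
    show "e / 2 > 0"
      using e by simp
    fix p w w'
    assume p: "dual_feasible x p" "dist p p0 < e / 2"
      and w: "w \<in> usphere" "w' \<in> usphere" "dist w w0 < e / 2" "dist w' w0 < e / 2"
        "p \<bullet> kvec x w = s" "p \<bullet> kvec x w' = s"
    define J J' where "J = {j. w \<bullet> x j \<noteq> 0}" and "J' = {j. w' \<bullet> x j \<noteq> 0}"
    define \<pi> \<pi>' where "\<pi> = (\<lambda>j. w \<bullet> x j > 0)" and "\<pi>' = (\<lambda>j. w' \<bullet> x j > 0)"
    note 1 = near[OF p w(1,3,5) J_def \<pi>_def] and 2 = near[OF p w(2,4,6) J'_def \<pi>'_def]
    have mem: "w \<in> stratum x \<pi> J" "w' \<in> stratum x \<pi>' J'" "w0 \<in> stratum x \<pi>0 J0"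
      using mem_stratum_self by (auto simp: J_def J'_def \<pi>_def \<pi>'_def J0_def \<pi>0_def)
    have "s *\<^sub>R w0 \<noteq> 0"
      using s w0 by auto
    \<comment> \<open>The condition (ND) speaks only about \<open>J0 \<subset> UNIV\<close>. If
      \<open>J0 = UNIV\<close>, all signs are already fixed and the compatible family has a single
      member.\<close>
    have "stratum x \<pi> J = stratum x \<pi>' J'"
    proof (cases "J0 = UNIV")
      case True
      then have "stratum x \<pi>'' J'' = stratum x \<pi>0 J0"
        if "stratum x \<pi>'' J'' \<in> compatible_strata x \<pi>0 J0" for \<pi>'' J''
      proof -
        from that obtain \<pi>3 J3 where eq: "stratum x \<pi>'' J'' = stratum x \<pi>3 J3"
          and sub: "J0 \<subseteq> J3" and "\<forall>j\<in>J0. \<pi>3 j = \<pi>0 j"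
          unfolding compatible_strata_def mem_Collect_eq by (elim exE conjE)
        then have "\<pi>3 = \<pi>0"
          using True by (intro ext) simp
        moreover have "J3 = J0"
          using sub True by auto
        ultimately show ?thesis
          using eq by simp
      qed
      then show ?thesis
        using 1 2 by metis
    next
      case False
      then have "J0 \<subset> UNIV"
        by auto
      then show ?thesis
        using ND[OF _ mem(3) conjunct1[OF 1] conjunct1[OF 2]] 1 2 \<open>s *\<^sub>R w0 \<noteq> 0\<close> by fastforce
    qed
    then show "w = w'"
      using saturated_unique_in_stratum[OF p(1) w(1) _ w(5,2) _ w(6) s] mem by auto
  qed
qed

section \<open>Stability\<close>

text \<open>Linear functionals dual to the independent family read off the coefficients, and each is
  bounded. The added 1 keeps the constant positive when \<open>I\<close> is empty.\<close>

lemma independent_coefficient_bound: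
  fixes v :: "'i \<Rightarrow> 'b::euclidean_space"
  assumes I: "finite I" "inj_on v I" "independent (v ` I)"
  obtains M where "M > 0" "\<And>a. (\<Sum>i\<in>I. \<bar>a i\<bar>) \<le> M * norm (\<Sum>i\<in>I. a i *\<^sub>R v i)"
proof -
  have "\<exists>g :: 'b \<Rightarrow> real. linear g \<and> (\<forall>u\<in>v ` I. g u = of_bool (u = v i))" for i
    by (rule linear_independent_extend[OF I(3)])
  then obtain g :: "'i \<Rightarrow> 'b \<Rightarrow> real" where g: "\<And>i. linear (g i)"
    "\<And>i u. u \<in> v ` I \<Longrightarrow> g i u = of_bool (u = v i)"
    by metis
  obtain B where B: "\<And>i. B i > 0" "\<And>i u. norm (g i u) \<le> B i * norm u"
  proof -
    have "\<exists>B>0. \<forall>u. norm (g i u) \<le> B * norm u" for i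
      using linear_bounded_pos[OF g(1)[of i]] by blast
    then show thesis
      using that by metis
  qed
  show thesis
  proof
    show "(\<Sum>i\<in>I. B i) + 1 > 0"
      using B(1) by (intro add_nonneg_pos sum_nonneg) (auto simp: less_imp_le)
    fix a :: "'i \<Rightarrow> real"
    let ?s = "\<Sum>i\<in>I. a i *\<^sub>R v i"
    have "a j = g j ?s" if j: "j \<in> I" for j
    proof -
      have "g j ?s = (\<Sum>i\<in>I. a i * g j (v i))"
        using g(1)[of j] by (simp add: linear_sum linear_scale)
      also have "\<dots> = (\<Sum>i\<in>I. if i = j then a j else 0)"
        using g(2) j I by (intro sum.cong) (auto simp: inj_on_def)
      finally show ?thesis
        using I j by simp
    qed
    then have "(\<Sum>i\<in>I. \<bar>a i\<bar>) = (\<Sum>i\<in>I. norm (g i ?s))"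
      by (intro sum.cong) auto
    also have "\<dots> \<le> (\<Sum>i\<in>I. B i * norm ?s)"
      by (intro sum_mono B)
    also have "\<dots> \<le> ((\<Sum>i\<in>I. B i) + 1) * norm ?s"
      by (simp add: sum_distrib_right algebra_simps)
    finally show "(\<Sum>i\<in>I. \<bar>a i\<bar>) \<le> ((\<Sum>i\<in>I. B i) + 1) * norm ?s" .
  qed
qed

text \<open>Expanding \<open>(a i - b i) *\<^sub>R V i\<close> leaves the error term with
  \<open>a i *\<^sub>R (U i - V i)\<close>, of norm at most \<open>e\<close> times the sum of
  \<open>\<bar>a i - b i\<bar> + \<bar>b i\<bar>\<close>. As \<open>M * e \<le> 1/2\<close>, the
  part with \<open>a i - b i\<close> is absorbed into the left side, so no prior bound on
  \<open>a\<close> enters.\<close>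

lemma coefficients_stable:
  fixes U V :: "'i \<Rightarrow> 'b::real_normed_vector" and a b :: "'i \<Rightarrow> real"
  assumes M: "M > 0" "\<And>a. (\<Sum>i\<in>I. \<bar>a i\<bar>) \<le> M * norm (\<Sum>i\<in>I. a i *\<^sub>R V i)"
    and e: "M * e \<le> 1/2" "\<And>i. i \<in> I \<Longrightarrow> norm (U i - V i) \<le> e" "e \<ge> 0"
  shows "(\<Sum>i\<in>I. \<bar>a i - b i\<bar>)
    \<le> 2 * M * (norm ((\<Sum>i\<in>I. a i *\<^sub>R U i) - (\<Sum>i\<in>I. b i *\<^sub>R V i)) + e * (\<Sum>i\<in>I. \<bar>b i\<bar>))"
proof -
  let ?D = "\<Sum>i\<in>I. \<bar>a i - b i\<bar>" and ?B = "\<Sum>i\<in>I. \<bar>b i\<bar>"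
  let ?n = "norm ((\<Sum>i\<in>I. a i *\<^sub>R U i) - (\<Sum>i\<in>I. b i *\<^sub>R V i))"
  have "(\<Sum>i\<in>I. (a i - b i) *\<^sub>R V i)
      = ((\<Sum>i\<in>I. a i *\<^sub>R U i) - (\<Sum>i\<in>I. b i *\<^sub>R V i)) - (\<Sum>i\<in>I. a i *\<^sub>R (U i - V i))"
    by (simp add: sum_subtractf[symmetric] algebra_simps)
  then have "norm (\<Sum>i\<in>I. (a i - b i) *\<^sub>R V i) \<le> ?n + norm (\<Sum>i\<in>I. a i *\<^sub>R (U i - V i))"
    by (simp add: norm_triangle_ineq4)
  also have "norm (\<Sum>i\<in>I. a i *\<^sub>R (U i - V i)) \<le> (\<Sum>i\<in>I. \<bar>a i\<bar> * e)"
    using e by (intro sum_norm_le) (simp add: mult_left_mono)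
  also have "\<dots> \<le> (\<Sum>i\<in>I. (\<bar>a i - b i\<bar> + \<bar>b i\<bar>) * e)"
    using e by (intro sum_mono mult_right_mono) auto
  also have "\<dots> = e * (?D + ?B)"
    by (simp add: sum.distrib sum_distrib_left algebra_simps)
  finally have "norm (\<Sum>i\<in>I. (a i - b i) *\<^sub>R V i) \<le> ?n + e * (?D + ?B)"
    by simp
  then have "M * norm (\<Sum>i\<in>I. (a i - b i) *\<^sub>R V i) \<le> M * (?n + e * (?D + ?B))"
    using M by simp
  then have "?D \<le> M * (?n + e * (?D + ?B))"
    using M(2)[of "\<lambda>i. a i - b i"] by linarith
  also have "\<dots> = M * ?n + M * e * ?B + M * e * ?D"
    by (simp add: algebra_simps)
  also have "M * e * ?D \<le> 1/2 * ?D"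
    using e(1) by (intro mult_right_mono) (auto intro: sum_nonneg)
  finally have "?D \<le> 2 * (M * ?n + M * e * ?B)"
    by simp
  then show ?thesis
    by (simp add: algebra_simps)
qed

section \<open>The dual solution and its saturated points for small regularisation\<close>

lemma closed_dual_feasible: "closed {p. dual_feasible x p}"
proof -
  have "{p. dual_feasible x p} = (\<Inter>w\<in>usphere. {p. \<bar>p \<bullet> kvec x w\<bar> \<le> 1})"
    by (auto simp: dual_feasible_iff)
  then show ?thesis
    by (auto intro!: closed_INT closed_Collect_le continuous_intros)
qed

text \<open>The midpoint of \<open>p\<close> and \<open>q\<close> is feasible and again maximises
  the dual interpolation objective, but by the parallelogram identity its norm is strictly smaller
  unless \<open>p = q\<close>.\<close>

lemma minimal_norm_unique:
  assumes p: "minimal_norm_dual_solution x y p"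
    and q: "dual_feasible x q" "p \<bullet> y \<le> q \<bullet> y" "norm q \<le> norm p"
  shows "q = p"
proof (rule ccontr)
  assume "q \<noteq> p"
  have ps: "dual_feasible x p" "\<And>p'. dual_feasible x p' \<Longrightarrow> p' \<bullet> y \<le> p \<bullet> y"
    using p by (auto simp: minimal_norm_dual_solution_def dual_interpolation_solution_def
        is_arg_min_def is_arg_max_def not_less)
  define m where "m = (1/2) *\<^sub>R p + (1/2) *\<^sub>R q"
  have "convex (\<Inter>w\<in>usphere. {p. p \<bullet> kvec x w \<le> 1} \<inter> {p. p \<bullet> kvec x w \<ge> -1})"
    by (intro convex_INT convex_Int)
      (auto simp: inner_commute[of _ "kvec x _"] convex_halfspace_le convex_halfspace_ge)
  moreover have "(\<Inter>w\<in>usphere. {p. p \<bullet> kvec x w \<le> 1} \<inter> {p. p \<bullet> kvec x w \<ge> -1}) = {p. dual_feasible x p}"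
    by (fastforce simp: dual_feasible_iff abs_le_iff)
  ultimately have "m \<in> {p. dual_feasible x p}"
    unfolding m_def using ps q by (intro convexD) auto
  moreover have "p \<bullet> y \<le> m \<bullet> y"
    using q by (simp add: m_def inner_add_left)
  ultimately have "dual_interpolation_solution x y m"
    using ps(2) by (auto simp: dual_interpolation_solution_def is_arg_max_def not_less intro: order_trans)
  then have "norm p \<le> norm m"
    using p by (auto simp: minimal_norm_dual_solution_def is_arg_min_def not_less)
  then have "(norm p)\<^sup>2 \<le> (norm m)\<^sup>2"
    by (intro power_mono) auto
  moreover have "(norm m)\<^sup>2 = (norm p)\<^sup>2 / 2 + (norm q)\<^sup>2 / 2 - (norm (p - q))\<^sup>2 / 4"
    unfolding m_def power2_norm_eq_inner by (simp add: algebra_simps inner_commute) (simp add: field_simps)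
  moreover have "(norm q)\<^sup>2 \<le> (norm p)\<^sup>2"
    using q by (intro power_mono) auto
  moreover have "(norm (p - q))\<^sup>2 > 0"
    using \<open>q \<noteq> p\<close> by simp
  ultimately show False
    by linarith
qed

lemma inverse_Suc_tendsto_0: "(\<lambda>k. 1 / real (Suc k)) \<longlonglongrightarrow> 0"
  using LIMSEQ_inverse_real_of_nat by (simp add: inverse_eq_divide)

text \<open>Along a sequence with \<alpha> and \<open>l0\<close> both tending to 0, comparison with
  \<open>p0\<close> in the dual objective bounds the dual solutions. A limit point is feasible, has
  at least the value of \<open>p0\<close> and at most its norm, hence is \<open>p0\<close>.\<close>

lemma training_dual_near:
  fixes x :: "'n::finite \<Rightarrow> real^'d" and y0 p0 :: "real^'n"
  assumes p0: "minimal_norm_dual_solution x y0 p0" and e: "e > 0"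
  shows "\<exists>\<alpha>>0. \<exists>l0>0. \<forall>(l, \<zeta>)\<in>admissible \<alpha> l0. dist (training_dual_solution x l (y0 + \<zeta>)) p0 < e"
proof (rule ccontr)
  assume contra: "\<not> ?thesis"
  have p0s: "dual_feasible x p0" "\<And>p'. dual_feasible x p' \<Longrightarrow> p' \<bullet> y0 \<le> p0 \<bullet> y0"
    using p0 by (auto simp: minimal_norm_dual_solution_def dual_interpolation_solution_def
        is_arg_min_def is_arg_max_def not_less)
  let ?a = "\<lambda>k. 1 / real (Suc k)"
  have "\<exists>l \<zeta>. (l, \<zeta>) \<in> admissible (?a k) (?a k) \<and>
      e \<le> dist (training_dual_solution x l (y0 + \<zeta>)) p0" for k
  proof -
    have "?a k > 0" by simp
    then have "\<not> (\<forall>(l, \<zeta>)\<in>admissible (?a k) (?a k). dist (training_dual_solution x l (y0 + \<zeta>)) p0 < e)"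
      using contra by blast
    then obtain q where "q \<in> admissible (?a k) (?a k)"
      "\<not> dist (training_dual_solution x (fst q) (y0 + snd q)) p0 < e"
      unfolding case_prod_unfold by blast
    then show ?thesis
      by (intro exI[of _ "fst q"] exI[of _ "snd q"]) (simp add: not_less)
  qed
  then obtain l \<zeta> where adm: "\<And>k. (l k, \<zeta> k) \<in> admissible (?a k) (?a k)"
    and far: "\<And>k. e \<le> dist (training_dual_solution x (l k) (y0 + \<zeta> k)) p0"
    by metis
  define P where "P = (\<lambda>k. training_dual_solution x (l k) (y0 + \<zeta> k))"
  have l: "0 < l k" "l k \<le> ?a k" "norm (\<zeta> k) \<le> ?a k * l k" for k
    using adm[of k] by (auto simp: admissible_def)
  have a: "0 < ?a k" "?a k \<le> 1" for k
    by auto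
  have feas: "dual_feasible x (P k)" for k
    using training_solutions(1)[OF l(1)] by (simp add: P_def)
  have opt: "y0 \<bullet> p0 + \<zeta> k \<bullet> p0 - l k / 2 * (norm p0)\<^sup>2
      \<le> y0 \<bullet> P k + \<zeta> k \<bullet> P k - l k / 2 * (norm (P k))\<^sup>2" for k
    using training_solutions(2)[OF l(1)[of k] p0s(1), of "y0 + \<zeta> k"]
    unfolding P_def inner_add_left by simp
  have le: "y0 \<bullet> P k \<le> y0 \<bullet> p0" for k
    using p0s(2)[OF feas[of k]] by (simp add: inner_commute)
  \<comment> \<open>The factor \<open>l k\<close> in the noise bound matches that of the quadratic
    term, so it cancels in \<open>sq\<close> and only the vanishing factor
    \<open>1 / real (Suc k)\<close> remains.\<close>
  have cs: "\<zeta> k \<bullet> P k - \<zeta> k \<bullet> p0 \<le> l k * (?a k * norm (P k - p0))" for k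
  proof -
    have "\<zeta> k \<bullet> (P k - p0) \<le> norm (\<zeta> k) * norm (P k - p0)"
      by (rule norm_cauchy_schwarz)
    also have "\<dots> \<le> ?a k * l k * norm (P k - p0)"
      using l(3) by (intro mult_right_mono) auto
    finally show ?thesis
      by (simp add: inner_diff_right mult_ac)
  qed
  have sq: "(norm (P k))\<^sup>2 \<le> (norm p0)\<^sup>2 + 2 * (?a k * norm (P k - p0))" for k
  proof -
    have "l k / 2 * (norm (P k))\<^sup>2 \<le> l k / 2 * (norm p0)\<^sup>2 + l k * (?a k * norm (P k - p0))"
      using opt[of k] cs[of k] le[of k] by linarith
    also have "\<dots> = l k / 2 * ((norm p0)\<^sup>2 + 2 * (?a k * norm (P k - p0)))"
      by (simp add: algebra_simps)
    finally show ?thesis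
      using l(1)[of k] by simp
  qed
  have diff: "norm (P k - p0) \<le> norm (P k) + norm p0" for k
    by (rule norm_triangle_ineq4)
  \<comment> \<open>The constant 2 arises by factoring \<open>sq\<close>: the difference of squares
    is at most \<open>2 * (norm (P k) + norm p0)\<close>, hence
    \<open>norm (P k) - norm p0 \<le> 2\<close>.\<close>
  have bd: "norm (P k) \<le> norm p0 + 2" for k
  proof (rule ccontr)
    assume "\<not> norm (P k) \<le> norm p0 + 2"
    then have "2 * (norm (P k) + norm p0) < (norm (P k) - norm p0) * (norm (P k) + norm p0)"
      using norm_ge_zero[of p0] by (intro mult_strict_right_mono) linarith+
    moreover have "?a k * norm (P k - p0) \<le> norm (P k) + norm p0"
      using diff[of k] mult_right_mono[OF a(2), of "norm (P k - p0)" k] by simp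
    ultimately show False
      using sq[of k] by (simp add: algebra_simps power2_eq_square)
  qed
  have "compact (cball 0 (norm p0 + 2) :: (real^'n) set)" "\<forall>k. P k \<in> cball 0 (norm p0 + 2)"
    using bd by auto
  then obtain q r where qr: "strict_mono r" "(P \<circ> r) \<longlonglongrightarrow> q"
    unfolding compact_def by metis
  have a0: "(\<lambda>k. ?a (r k)) \<longlonglongrightarrow> 0"
    using LIMSEQ_subseq_LIMSEQ[OF inverse_Suc_tendsto_0 qr(1)] by (simp add: comp_def)
  have l0: "(\<lambda>k. l (r k)) \<longlonglongrightarrow> 0"
    by (rule tendsto_sandwich[OF _ _ tendsto_const a0])
      (intro always_eventually allI less_imp_le[OF l(1)] l(2))+
  have Pq: "(\<lambda>k. P (r k)) \<longlonglongrightarrow> q"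
    using qr(2) by (simp add: comp_def)
  have "dual_feasible x q"
    using closed_sequentially[OF closed_dual_feasible, of "P \<circ> r" x q] feas qr(2) by auto
  moreover have "norm q \<le> norm p0"
  proof -
    have "(\<lambda>k. (norm p0)\<^sup>2 + 2 * (?a (r k) * norm (P (r k) - p0))) \<longlonglongrightarrow>
        (norm p0)\<^sup>2 + 2 * (0 * norm (q - p0))"
      by (intro tendsto_intros Pq a0)
    moreover have "(\<lambda>k. (norm (P (r k)))\<^sup>2) \<longlonglongrightarrow> (norm q)\<^sup>2"
      by (intro tendsto_intros Pq)
    ultimately have "(norm q)\<^sup>2 \<le> (norm p0)\<^sup>2 + 2 * (0 * norm (q - p0))"
      using sq by (intro LIMSEQ_le) auto
    then show ?thesis
      by (simp add: power2_le_iff_abs_le)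
  qed
  moreover have "p0 \<bullet> y0 \<le> q \<bullet> y0"
  proof -
    have "p0 \<bullet> y0 - l (r k) / 2 * (norm p0)\<^sup>2 - l (r k) * (?a (r k) * norm (P (r k) - p0)) \<le> P (r k) \<bullet> y0" for k
    proof -
      have "0 \<le> l (r k) / 2 * (norm (P (r k)))\<^sup>2"
        using l(1)[of "r k"] by simp
      then show ?thesis
        using opt[of "r k"] cs[of "r k"] unfolding inner_commute[of _ y0] by linarith
    qed
    moreover have "(\<lambda>k. p0 \<bullet> y0 - l (r k) / 2 * (norm p0)\<^sup>2 - l (r k) * (?a (r k) * norm (P (r k) - p0)))
       \<longlonglongrightarrow> p0 \<bullet> y0 - 0 / 2 * (norm p0)\<^sup>2 - 0 * (0 * norm (q - p0))"
      by (intro tendsto_intros Pq a0 l0) simp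
    moreover have "(\<lambda>k. P (r k) \<bullet> y0) \<longlonglongrightarrow> q \<bullet> y0"
      by (intro tendsto_intros Pq)
    ultimately have "p0 \<bullet> y0 - 0 / 2 * (norm p0)\<^sup>2 - 0 * (0 * norm (q - p0)) \<le> q \<bullet> y0"
      by (intro LIMSEQ_le) auto
    then show ?thesis
      by simp
  qed
  ultimately have "q = p0"
    by (intro minimal_norm_unique[OF p0])
  moreover have "e \<le> dist q p0"
    by (rule tendsto_lowerbound[OF tendsto_dist[OF Pq tendsto_const]]) (use far in \<open>auto simp: P_def\<close>)
  ultimately show False
    using e by simp
qed

text \<open>
  The perturbed dual solutions need not converge to \<open>p0\<close> when \<open>\<zeta>\<close> is only \<open>O(l)\<close>, but all their
  limit points maximise \<open>\<lambda>q. q \<bullet> y0\<close>, which is what \<open>limit\<close> requires.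
\<close>
lemma saturated_points_converge:
  fixes x :: "'n::finite \<Rightarrow> real^'d" and y0 p0 :: "real^'n"
  assumes p0: "dual_feasible x p0" and r: "r > 0"
    and limit: "\<And>q w. dual_feasible x q \<Longrightarrow> p0 \<bullet> y0 \<le> q \<bullet> y0 \<Longrightarrow> dist q p0 < r \<Longrightarrow> w \<in> usphere \<Longrightarrow>
      dist w v < r \<Longrightarrow> q \<bullet> kvec x w = s \<Longrightarrow> w = v"
    and near: "\<And>l \<zeta>. (l, \<zeta>) \<in> admissible \<alpha> l0 \<Longrightarrow>
      dist (training_dual_solution x l (y0 + \<zeta>)) p0 < r / 2 \<and> w l \<zeta> \<in> usphere \<and> dist (w l \<zeta>) v < r / 2 \<and>
      training_dual_solution x l (y0 + \<zeta>) \<bullet> kvec x (w l \<zeta>) = s"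
  shows "((\<lambda>(l, \<zeta>). w l \<zeta>) \<longlongrightarrow> v) (at (0, 0) within admissible \<alpha> l0)"
proof (rule ccontr)
  assume "\<not> ?thesis"
  then obtain e where e: "e > 0"
    "\<And>d. d > 0 \<Longrightarrow> \<exists>q\<in>admissible \<alpha> l0. dist q (0, 0) < d \<and> e \<le> dist (w (fst q) (snd q)) v"
    unfolding tendsto_iff eventually_at case_prod_unfold by (meson not_less)
  let ?a = "\<lambda>k. 1 / real (Suc k)"
  have "\<exists>l \<zeta>. (l, \<zeta>) \<in> admissible \<alpha> l0 \<and> dist (l, \<zeta>) (0, 0) < ?a k \<and> e \<le> dist (w l \<zeta>) v" for k
  proof -
    have "?a k > 0" by simp
    from e(2)[OF this] show ?thesis
      by force
  qed
  then obtain l \<zeta> where adm: "\<And>k. (l k, \<zeta> k) \<in> admissible \<alpha> l0"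
    and small: "\<And>k. dist (l k, \<zeta> k) (0, 0) < ?a k" and far: "\<And>k. e \<le> dist (w (l k) (\<zeta> k)) v"
    by metis
  define P where "P = (\<lambda>k. training_dual_solution x (l k) (y0 + \<zeta> k))"
  define W where "W = (\<lambda>k. w (l k) (\<zeta> k))"
  have lpos: "0 < l k" for k
    using adm[of k] by (auto simp: admissible_def)
  have "(\<lambda>k. dist (l k, \<zeta> k) (0, 0)) \<longlonglongrightarrow> 0"
    by (rule tendsto_sandwich[OF _ _ tendsto_const inverse_Suc_tendsto_0])
      (intro always_eventually allI zero_le_dist less_imp_le[OF small])+
  then have "(\<lambda>k. (l k, \<zeta> k)) \<longlonglongrightarrow> (0, 0)"
    by (subst tendsto_dist_iff)
  from tendsto_fst[OF this] tendsto_snd[OF this] have lim0: "l \<longlonglongrightarrow> 0" "\<zeta> \<longlonglongrightarrow> 0"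
    by simp_all
  \<comment> \<open>Closed balls of radius \<open>r / 2\<close> keep the limit points inside the
    open balls of radius \<open>r\<close> required by \<open>limit\<close>.\<close>
  have "seq_compact (cball p0 (r / 2) \<times> (usphere \<inter> cball v (r / 2)))"
    by (intro compact_imp_seq_compact compact_Times compact_Int) auto
  moreover have "\<forall>k. (P k, W k) \<in> cball p0 (r / 2) \<times> (usphere \<inter> cball v (r / 2))"
    using near[OF adm] by (auto simp: P_def W_def dist_commute less_imp_le)
  ultimately obtain qu \<rho> where "qu \<in> cball p0 (r / 2) \<times> (usphere \<inter> cball v (r / 2))"
    and rho: "strict_mono \<rho>" "((\<lambda>k. (P k, W k)) \<circ> \<rho>) \<longlonglongrightarrow> qu"
    by (rule seq_compactE)
  then obtain q u where qu: "qu = (q, u)" "dist q p0 \<le> r / 2" "u \<in> usphere" "dist u v \<le> r / 2"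
    by (auto simp: dist_commute)
  have Pq: "(\<lambda>k. P (\<rho> k)) \<longlonglongrightarrow> q" and Wu: "(\<lambda>k. W (\<rho> k)) \<longlonglongrightarrow> u"
    using tendsto_fst[OF rho(2)] tendsto_snd[OF rho(2)] qu by (simp_all add: comp_def)
  have lr: "(\<lambda>k. l (\<rho> k)) \<longlonglongrightarrow> 0" "(\<lambda>k. \<zeta> (\<rho> k)) \<longlonglongrightarrow> 0"
    using LIMSEQ_subseq_LIMSEQ[OF _ rho(1)] lim0 by (auto simp: comp_def)
  have feas: "dual_feasible x (P k)" for k
    using training_solutions(1)[OF lpos] by (simp add: P_def)
  then have "dual_feasible x q"
    using closed_sequentially[OF closed_dual_feasible, of "\<lambda>k. P (\<rho> k)" x q] Pq by auto
  moreover have "p0 \<bullet> y0 \<le> q \<bullet> y0"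
  proof -
    have "(y0 + \<zeta> k) \<bullet> p0 - l k / 2 * (norm p0)\<^sup>2 \<le> (y0 + \<zeta> k) \<bullet> P k - l k / 2 * (norm (P k))\<^sup>2" for k
      using training_solutions(2)[OF lpos p0] by (simp add: P_def)
    moreover have "(\<lambda>k. (y0 + \<zeta> (\<rho> k)) \<bullet> p0 - l (\<rho> k) / 2 * (norm p0)\<^sup>2) \<longlonglongrightarrow> (y0 + 0) \<bullet> p0 - 0 / 2 * (norm p0)\<^sup>2"
      by (intro tendsto_intros lr) simp
    moreover have "(\<lambda>k. (y0 + \<zeta> (\<rho> k)) \<bullet> P (\<rho> k) - l (\<rho> k) / 2 * (norm (P (\<rho> k)))\<^sup>2)
        \<longlonglongrightarrow> (y0 + 0) \<bullet> q - 0 / 2 * (norm q)\<^sup>2"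
      by (intro tendsto_intros lr Pq) simp
    ultimately have "(y0 + 0) \<bullet> p0 - 0 / 2 * (norm p0)\<^sup>2 \<le> (y0 + 0) \<bullet> q - 0 / 2 * (norm q)\<^sup>2"
      by (intro LIMSEQ_le) auto
    then show ?thesis
      by (simp add: inner_commute)
  qed
  moreover have "q \<bullet> kvec x u = s"
  proof -
    have "isCont (kvec x) u"
      using continuous_on_kvec[of UNIV x] by (simp add: continuous_on_eq_continuous_at)
    then have "(\<lambda>k. P (\<rho> k) \<bullet> kvec x (W (\<rho> k))) \<longlonglongrightarrow> q \<bullet> kvec x u"
      by (intro tendsto_intros Pq isCont_tendsto_compose[OF _ Wu])
    moreover have "P k \<bullet> kvec x (W k) = s" for k
      using near[OF adm] by (simp add: P_def W_def)
    ultimately show ?thesis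
      by (simp add: LIMSEQ_const_iff)
  qed
  ultimately have "u = v"
    using qu r by (intro limit[of q]) auto
  moreover have "e \<le> dist u v"
    by (rule tendsto_lowerbound[OF tendsto_dist[OF Wu tendsto_const]]) (use far in \<open>auto simp: W_def\<close>)
  ultimately show False
    using e by simp
qed

text \<open>Uniqueness is up to a permutation because exchanging two indices of equal sign
  represents the same measures. On the admissible set \<open>l\<close> tending to 0 forces \<zeta>
  to 0, so the filter at \<open>(0, 0)\<close> is the stated regime. The limit of the weights is
  claimed for every family of weights producing solutions.\<close>

theorem proposition4p5:
  fixes x :: "'n::finite \<Rightarrow> real^'d"
    and N :: nat
    and c0 \<sigma> :: "nat \<Rightarrow> real"
    and w0 :: "nat \<Rightarrow> real^'d"
    and Js :: "nat \<Rightarrow> 'n set"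
    and \<pi>s :: "nat \<Rightarrow> 'n \<Rightarrow> bool"
    and \<mu>0 :: "(real^'d) set \<Rightarrow> real"
    and y0 p0 :: "real^'n"
  assumes data_nonzero: "\<And>j. x j \<noteq> 0"
    and N_le: "N \<le> CARD('n)"
    and c0_pos: "\<And>i. i \<in> {1..N} \<Longrightarrow> c0 i > 0"
    and sign: "\<And>i. i \<in> {1..N} \<Longrightarrow> \<sigma> i \<in> {-1, 1}"
    and w0: "\<And>i. i \<in> {1..N} \<Longrightarrow> w0 i \<in> closed_stratum x (\<pi>s i) (Js i) \<inter> usphere"
    and mu0: "\<mu>0 = (\<lambda>A. \<Sum>i=1..N. c0 i * \<sigma> i * dirac (w0 i) A)"
    and y0: "y0 = K_op x \<mu>0"
    and p0: "minimal_norm_dual_solution x y0 p0"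
    and certificate: "dual_certificate (K_adj x p0) \<mu>0"
    and LC: "\<And>w. w \<in> usphere - w0 ` {1..N} \<Longrightarrow> \<bar>K_adj x p0 w\<bar> < 1"
    and ND: "\<And>i \<pi> J \<pi>1 J1 \<pi>2 J2.
        i \<in> {1..N} \<Longrightarrow> J \<subset> UNIV \<Longrightarrow> w0 i \<in> stratum x \<pi> J \<Longrightarrow>
        stratum x \<pi>1 J1 \<in> compatible_strata x \<pi> J \<Longrightarrow>
        stratum x \<pi>2 J2 \<in> compatible_strata x \<pi> J \<Longrightarrow>
        stratum x \<pi>1 J1 \<noteq> stratum x \<pi>2 J2 \<Longrightarrow>
        z_tilde x p0 J1 \<pi>1 \<noteq> 0 \<Longrightarrow> z_tilde x p0 J2 \<pi>2 \<noteq> 0 \<Longrightarrow>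
        z_tilde x p0 J1 \<pi>1 /\<^sub>R norm (z_tilde x p0 J1 \<pi>1)
          \<noteq> z_tilde x p0 J2 \<pi>2 /\<^sub>R norm (z_tilde x p0 J2 \<pi>2)"
    and lin_indep: "inj_on (\<lambda>i. K_op x (dirac (w0 i))) {1..N}"
      "independent ((\<lambda>i. K_op x (dirac (w0 i))) ` {1..N})"
  shows "\<exists>\<alpha>>0. \<exists>l0>0. \<exists>w :: real \<Rightarrow> real^'n \<Rightarrow> nat \<Rightarrow> real^'d.
      (\<forall>(l, \<zeta>) \<in> admissible \<alpha> l0.
         represents_solutions x N \<sigma> l (y0 + \<zeta>) (w l \<zeta>) \<and>
         (\<forall>w'. represents_solutions x N \<sigma> l (y0 + \<zeta>) w' \<longrightarrow>
            (\<exists>\<tau>. \<tau> permutes {1..N} \<and> (\<forall>i\<in>{1..N}. w' i = w l \<zeta> (\<tau> i))))) \<and>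
      (\<forall>i\<in>{1..N}. ((\<lambda>(l, \<zeta>). w l \<zeta> i) \<longlongrightarrow> w0 i) (at (0, 0) within admissible \<alpha> l0)) \<and>
      (\<forall>c :: real \<Rightarrow> real^'n \<Rightarrow> nat \<Rightarrow> real.
         (\<forall>(l, \<zeta>) \<in> admissible \<alpha> l0.
            (\<forall>i\<in>{1..N}. c l \<zeta> i > 0) \<and>
            training_solution x l (y0 + \<zeta>)
              (\<lambda>A. \<Sum>i=1..N. c l \<zeta> i * \<sigma> i * dirac (w l \<zeta> i) A)) \<longrightarrow>
         (\<forall>i\<in>{1..N}. ((\<lambda>(l, \<zeta>). c l \<zeta> i) \<longlongrightarrow> c0 i) (at (0, 0) within admissible \<alpha> l0)))"
proof -

  \<comment> \<open>Notation and complementary slackness for the unperturbed problem\<close>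
  define I where "I = {1..N}"
  have finI: "finite I"
    by (simp add: I_def)
  note c0_pos = c0_pos[folded I_def] and sign = sign[folded I_def] and w0 = w0[folded I_def]
    and mu0 = mu0[folded I_def] and LC = LC[folded I_def] and ND = ND[folded I_def]
    and lin_indep = lin_indep[folded I_def]
  note represents_def = represents_solutions_def[of x N, folded I_def]
  define k where "k = (kvec x :: real^'d \<Rightarrow> real^'n)"
  define C where "C = (\<Sum>j\<in>UNIV. norm (x j))"
  have C: "C \<ge> 0" "\<And>w v. norm (k w - k v) \<le> C * dist w v" "\<And>w. w \<in> usphere \<Longrightarrow> norm (k w) \<le> C"
    using kvec_bounds[where x = x] by (auto simp: C_def k_def dist_norm intro: sum_nonneg)
  have w0s: "w0 i \<in> usphere" if "i \<in> I" for i
    using w0[OF that] by simp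
  have Kw0: "K_op x (dirac (w0 i)) = k (w0 i)" if "i \<in> I" for i
    using K_op_dirac[OF w0s[OF that]] by (simp add: k_def)
  have inj: "inj_on w0 I"
    by (rule inj_on_imageI2[of "\<lambda>w. K_op x (dirac w)"]) (use lin_indep(1) in \<open>simp add: comp_def\<close>)
  have kinj: "inj_on (\<lambda>i. k (w0 i)) I"
    using lin_indep(1) inj_on_cong[of I "\<lambda>i. K_op x (dirac (w0 i))" "\<lambda>i. k (w0 i)"] Kw0 by blast
  moreover have "independent ((\<lambda>i. k (w0 i)) ` I)"
    using lin_indep(2) image_cong[OF refl Kw0, of I] by simp
  ultimately obtain M where M: "M > 0" "\<And>a. (\<Sum>i\<in>I. \<bar>a i\<bar>) \<le> M * norm (\<Sum>i\<in>I. a i *\<^sub>R k (w0 i))"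
    using independent_coefficient_bound[OF finI] by blast
  have sg: "\<sigma> i * \<sigma> i = 1" "\<bar>\<sigma> i\<bar> = 1" if "i \<in> I" for i
    using sign[OF that] by auto
  have sub: "w0 ` I \<subseteq> usphere"
    using w0s by blast
  define S0 where "S0 = (\<Sum>i\<in>I. c0 i)"
  have S0: "S0 \<ge> 0" "(\<Sum>i\<in>I. \<bar>c0 i * \<sigma> i\<bar>) = S0"
  proof -
    show "S0 \<ge> 0"
      unfolding S0_def using c0_pos by (intro sum_nonneg) (simp add: less_imp_le)
    show "(\<Sum>i\<in>I. \<bar>c0 i * \<sigma> i\<bar>) = S0"
      unfolding S0_def using c0_pos sg(2) by (intro sum.cong) (simp_all add: abs_mult abs_of_pos)
  qed
  have y0_eq: "y0 = (\<Sum>i\<in>I. (c0 i * \<sigma> i) *\<^sub>R k (w0 i))"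
    unfolding y0 mu0 k_def by (rule K_op_discrete[OF finI inj sub])
  have p0_max: "dual_feasible x p0"
    using p0 by (auto simp: minimal_norm_dual_solution_def dual_interpolation_solution_def
        is_arg_min_def is_arg_max_def)
  have q_y0: "q \<bullet> y0 = (\<Sum>i\<in>I. c0 i * (\<sigma> i * (q \<bullet> k (w0 i))))" for q
    by (simp add: y0_eq inner_sum_right mult_ac)
  have p0_y0: "p0 \<bullet> y0 = S0"
  proof -
    have "signed_integral \<mu>0 (K_adj x p0) = (\<Sum>i\<in>I. c0 i * \<sigma> i * K_adj x p0 (w0 i))"
      unfolding mu0 by (rule signed_integral_discrete[OF finI inj sub continuous_on_K_adj])
    moreover have "tv_norm \<mu>0 = S0"
      unfolding mu0 using tv_norm_discrete[OF finI inj sub, of "\<lambda>i. c0 i * \<sigma> i"] S0 by simp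
    ultimately show ?thesis
      using certificate by (simp add: dual_certificate_def q_y0 K_adj_eq_inner k_def mult_ac)
  qed
  \<comment> \<open>\<open>S0 - q \<bullet> y0\<close> is a sum of nonnegative slacks with positive
    weights \<open>c0 j\<close>; maximality of \<open>q\<close> makes every slack vanish. The claim
    covers all maximisers, since limits of dual vectors need not be \<open>p0\<close>.\<close>
  have saturated_w0: "q \<bullet> k (w0 i) = \<sigma> i"
    if q: "dual_feasible x q" "p0 \<bullet> y0 \<le> q \<bullet> y0" and i: "i \<in> I" for q i
  proof -
    have le: "\<sigma> j * (q \<bullet> k (w0 j)) \<le> 1" if "j \<in> I" for j
    proof -
      have "\<bar>\<sigma> j * (q \<bullet> k (w0 j))\<bar> \<le> 1"
        using q(1) w0s[OF that] sg(2)[OF that] by (simp add: abs_mult dual_feasible_iff k_def)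
      then show ?thesis by linarith
    qed
    have "(\<Sum>j\<in>I. c0 j * (1 - \<sigma> j * (q \<bullet> k (w0 j)))) = S0 - q \<bullet> y0"
      by (simp add: q_y0 S0_def right_diff_distrib sum_subtractf)
    then have "(\<Sum>j\<in>I. c0 j * (1 - \<sigma> j * (q \<bullet> k (w0 j)))) \<le> 0"
      using q(2) p0_y0 by simp
    moreover have nn: "0 \<le> c0 j * (1 - \<sigma> j * (q \<bullet> k (w0 j)))" if "j \<in> I" for j
      using c0_pos[OF that] le[OF that] by simp
    ultimately have "(\<Sum>j\<in>I. c0 j * (1 - \<sigma> j * (q \<bullet> k (w0 j)))) = 0"
      by (intro antisym sum_nonneg) auto
    then have "c0 i * (1 - \<sigma> i * (q \<bullet> k (w0 i))) = 0"
      using sum_nonneg_eq_0_iff[OF finI, of "\<lambda>j. c0 j * (1 - \<sigma> j * (q \<bullet> k (w0 j)))"] nn i by blast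
    then have "\<sigma> i * (q \<bullet> k (w0 i)) = 1"
      using c0_pos[OF i] by simp
    then show ?thesis
      using sign[OF i] by auto
  qed
  note saturated_p0 = saturated_w0[OF p0_max order_refl]

  \<comment> \<open>Choice of the radius\<close>
  define local_uniq where "local_uniq = (\<lambda>i r. \<forall>p w w'. dual_feasible x p \<longrightarrow> dist p p0 < r \<longrightarrow>
    w \<in> usphere \<longrightarrow> w' \<in> usphere \<longrightarrow> dist w (w0 i) < r \<longrightarrow> dist w' (w0 i) < r \<longrightarrow>
    p \<bullet> k w = \<sigma> i \<longrightarrow> p \<bullet> k w' = \<sigma> i \<longrightarrow> w = w')"
  have uniq_ev: "\<forall>\<^sub>F r in at_right 0. local_uniq i r" if i: "i \<in> I" for i
  proof -
    have "\<exists>r>0. local_uniq i r"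
      unfolding local_uniq_def k_def
      by (rule saturated_locally_unique[OF w0s[OF i] sg(2)[OF i] ND[OF i]])
    then obtain r where r: "r > 0" "local_uniq i r"
      by blast
    show ?thesis
    proof (rule eventually_at_rightI[OF _ r(1)])
      fix r' assume "r' \<in> {0<..<r}"
      then have "r' < r" by simp
      then show "local_uniq i r'"
        unfolding local_uniq_def k_def
      proof (intro allI impI)
        fix p w w'
        assume *: "dual_feasible x p" "dist p p0 < r'" "w \<in> usphere" "w' \<in> usphere"
          "dist w (w0 i) < r'" "dist w' (w0 i) < r'" "p \<bullet> kvec x w = \<sigma> i" "p \<bullet> kvec x w' = \<sigma> i"
        show "w = w'"
          by (rule r(2)[unfolded local_uniq_def k_def, rule_format, OF *(1) less_trans[OF *(2) \<open>r' < r\<close>] *(3,4)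
                less_trans[OF *(5) \<open>r' < r\<close>] less_trans[OF *(6) \<open>r' < r\<close>] *(7,8)])
      qed
    qed
  qed
  have lim0: "((\<lambda>r. c * r) \<longlongrightarrow> 0) (at_right 0)" for c :: real
    by (auto intro!: tendsto_eq_intros)
  have small_ev: "\<forall>\<^sub>F r in at_right 0. c * r < d" if "d > 0" for c d :: real
    using order_tendstoD(2)[OF lim0 that] .
  have sep_ev: "\<forall>\<^sub>F r in at_right 0. 1 * r < (if i = j then 1 else dist (w0 i) (w0 j))"
    if "i \<in> I" "j \<in> I" for i j
    by (rule small_ev) (use that inj in \<open>auto simp: inj_on_def\<close>)
  have pos_ev: "\<forall>\<^sub>F r in at_right 0. 0 < (r :: real)"
    by (rule eventually_at_right_less)
  have "\<forall>\<^sub>F r in at_right 0. \<forall>i\<in>I. local_uniq i r"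
    by (intro eventually_ball_finite finI ballI uniq_ev)
  moreover have "\<forall>\<^sub>F r in at_right 0. \<forall>i\<in>I. \<forall>j\<in>I. 1 * r < (if i = j then 1 else dist (w0 i) (w0 j))"
    by (intro eventually_ball_finite finI ballI sep_ev)
  moreover have "\<forall>\<^sub>F r in at_right 0. \<forall>i\<in>I. (4 * M * C * S0) * r < c0 i"
    by (intro eventually_ball_finite finI ballI small_ev c0_pos)
  moreover have "\<forall>\<^sub>F r in at_right 0. (M * C) * r < 1/2" "\<forall>\<^sub>F r in at_right 0. (norm p0 * C) * r < 1/2"
    by (intro small_ev; simp)+
  ultimately have "\<forall>\<^sub>F r in at_right 0. 0 < r \<and> (\<forall>i\<in>I. local_uniq i r) \<and>
      (\<forall>i\<in>I. \<forall>j\<in>I. 1 * r < (if i = j then 1 else dist (w0 i) (w0 j))) \<and>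
      (\<forall>i\<in>I. 4 * M * C * S0 * r < c0 i) \<and> M * C * r < 1/2 \<and> norm p0 * C * r < 1/2"
    using pos_ev by (intro eventually_conj)
  \<comment> \<open>Separation makes balls of radius \<open>r / 2\<close> around distinct
    \<open>w0 i\<close> disjoint. The bound with \<open>S0\<close> keeps the weight error due to
    displaced points below \<open>c0 i / 2\<close>; \<open>M * C * r < 1/2\<close> is the absorption
    condition of \<open>coefficients_stable\<close>; the last bound fixes the sign of saturated
    points near \<open>w0 i\<close>.\<close>
  then obtain r where r': "0 < r \<and> (\<forall>i\<in>I. local_uniq i r) \<and>
      (\<forall>i\<in>I. \<forall>j\<in>I. 1 * r < (if i = j then 1 else dist (w0 i) (w0 j))) \<and>
      (\<forall>i\<in>I. 4 * M * C * S0 * r < c0 i) \<and> M * C * r < 1/2 \<and> norm p0 * C * r < 1/2"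
    using eventually_happens'[OF trivial_limit_at_right_real] by blast
  then have r: "r > 0" "\<And>i. i \<in> I \<Longrightarrow> local_uniq i r"
    "\<And>i. i \<in> I \<Longrightarrow> 4 * M * C * S0 * r < c0 i" "M * C * r < 1/2" "norm p0 * C * r < 1/2"
    by blast+
  have sep: "r < dist (w0 i) (w0 j)" if "i \<in> I" "j \<in> I" "i \<noteq> j" for i j
  proof -
    have "1 * r < (if i = j then 1 else dist (w0 i) (w0 j))"
      using r' that by blast
    then show ?thesis
      using that by simp
  qed

  \<comment> \<open>Localisation of the saturated points\<close>
  have "\<exists>\<delta>>0. \<forall>p w. dist p p0 < \<delta> \<longrightarrow> w \<in> usphere \<longrightarrow> \<bar>p \<bullet> k w\<bar> = 1 \<longrightarrow>
      (\<exists>i\<in>I. dist w (w0 i) < r / 2 \<and> p \<bullet> k w = \<sigma> i)"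
  proof -
    \<comment> \<open>On this compact remainder of the sphere (LC) improves to a uniform gap
      \<open>g\<close>, which survives a change of the dual vector by less than \<delta>.\<close>
    define Z where "Z = usphere - (\<Union>i\<in>I. ball (w0 i) (r / 2))"
    have Z: "compact Z"
      unfolding Z_def by (intro compact_diff) auto
    have "\<exists>g>0. \<forall>w\<in>Z. \<bar>p0 \<bullet> k w\<bar> \<le> 1 - g"
    proof (cases "Z = {}")
      case True
      then show ?thesis by (intro exI[of _ 1]) auto
    next
      case False
      have "continuous_on Z (\<lambda>w. \<bar>p0 \<bullet> k w\<bar>)"
        unfolding k_def by (intro continuous_intros continuous_on_kvec)
      then obtain z where z: "z \<in> Z" "\<And>w. w \<in> Z \<Longrightarrow> \<bar>p0 \<bullet> k w\<bar> \<le> \<bar>p0 \<bullet> k z\<bar>"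
        using continuous_attains_sup[OF Z False] by blast
      have "z \<in> usphere - w0 ` I"
        using z(1) r(1) by (auto simp: Z_def)
      then have "\<bar>p0 \<bullet> k z\<bar> < 1"
        using LC by (simp add: K_adj_eq_inner k_def)
      then show ?thesis
        using z(2) by (intro exI[of _ "1 - \<bar>p0 \<bullet> k z\<bar>"]) auto
    qed
    then obtain g where g: "g > 0" "\<And>w. w \<in> Z \<Longrightarrow> \<bar>p0 \<bullet> k w\<bar> \<le> 1 - g"
      by blast
    have "\<forall>\<^sub>F d in at_right 0. 0 < d \<and> C * d < min g (1/2)"
      using g(1) by (intro eventually_conj pos_ev small_ev) simp
    then obtain \<delta> where d: "\<delta> > 0" "C * \<delta> < min g (1/2)"
      using eventually_happens'[OF trivial_limit_at_right_real] by blast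
    have "\<exists>i\<in>I. dist w (w0 i) < r / 2 \<and> p \<bullet> k w = \<sigma> i"
      if p: "dist p p0 < \<delta>" and w: "w \<in> usphere" "\<bar>p \<bullet> k w\<bar> = 1" for p w
    proof -
      have "\<bar>(p - p0) \<bullet> k w\<bar> \<le> norm (p - p0) * norm (k w)"
        by (rule Cauchy_Schwarz_ineq2)
      also have "\<dots> \<le> \<delta> * C"
        using p C(3)[OF w(1)] by (intro mult_mono) (auto simp: dist_norm less_imp_le[OF d(1)])
      finally have close: "\<bar>p \<bullet> k w - p0 \<bullet> k w\<bar> < g" "\<bar>p \<bullet> k w - p0 \<bullet> k w\<bar> < 1/2"
        using d by (auto simp: inner_diff_left mult.commute)
      have "w \<notin> Z"
        using g(2)[of w] close w(2) by linarith
      then obtain i where i: "i \<in> I" "dist w (w0 i) < r / 2"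
        using w by (auto simp: Z_def dist_commute)
      have "\<bar>p0 \<bullet> (k w - k (w0 i))\<bar> \<le> norm p0 * norm (k w - k (w0 i))"
        by (rule Cauchy_Schwarz_ineq2)
      also have "\<dots> \<le> norm p0 * (C * r)"
        using C(1) i r(1)
        by (intro mult_left_mono order_trans[OF C(2)]) auto
      finally have "\<bar>p0 \<bullet> k w - \<sigma> i\<bar> < 1/2"
        using r(5) saturated_p0[OF i(1)] by (simp add: inner_diff_right mult.assoc)
      moreover have "\<sigma> i = 1 \<or> \<sigma> i = - 1"
        using sign[OF i(1)] by auto
      \<comment> \<open>Both numbers are 1 or -1, and two errors below 1/2 put them at distance less
        than 1.\<close>
      ultimately have "p \<bullet> k w = \<sigma> i"
        using close(2) w(2) by (smt (verit) field_sum_of_halves)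
      then show ?thesis
        using i by blast
    qed
    then show ?thesis
      using d(1) by blast
  qed
  then obtain \<delta> where \<delta>: "\<delta> > 0" "\<And>p w. dist p p0 < \<delta> \<Longrightarrow> w \<in> usphere \<Longrightarrow> \<bar>p \<bullet> k w\<bar> = 1 \<Longrightarrow>
      \<exists>i\<in>I. dist w (w0 i) < r / 2 \<and> p \<bullet> k w = \<sigma> i"
    by blast

  \<comment> \<open>Choice of the admissible region\<close>
  define P where "P = (\<lambda>l \<zeta>. training_dual_solution x l (y0 + \<zeta>))"
  obtain \<alpha> l1 where al: "\<alpha> > 0" "l1 > 0"
    "\<And>l \<zeta>. (l, \<zeta>) \<in> admissible \<alpha> l1 \<Longrightarrow> dist (P l \<zeta>) p0 < min \<delta> (r / 2)"
    using training_dual_near[OF p0, of "min \<delta> (r / 2)"] \<delta>(1) r(1) unfolding P_def by fastforce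
  \<comment> \<open>\<open>D * l\<close> bounds the residual
    \<open>\<zeta> - l *\<^sub>R P l \<zeta>\<close>: \<alpha> accounts for the noise, and
    \<open>norm p0 + r\<close> bounds the dual vector.\<close>
  define D where "D = \<alpha> + norm p0 + r"
  have "\<forall>\<^sub>F l0 in at_right 0. \<forall>i\<in>I. (2 * M * D) * l0 < c0 i / 2"
    by (intro eventually_ball_finite finI ballI small_ev half_gt_zero c0_pos)
  then have "\<forall>\<^sub>F l0 in at_right 0. 0 < l0 \<and> 1 * l0 < l1 \<and> (\<forall>i\<in>I. 2 * M * D * l0 < c0 i / 2)"
    by (intro eventually_conj pos_ev small_ev al(2))
  then obtain l0 where "0 < l0 \<and> 1 * l0 < l1 \<and> (\<forall>i\<in>I. 2 * M * D * l0 < c0 i / 2)"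
    using eventually_happens'[OF trivial_limit_at_right_real] by blast
  then have l0: "l0 > 0" "l0 < l1" "\<And>i. i \<in> I \<Longrightarrow> 2 * M * D * l0 < c0 i / 2"
    by simp_all
  have adm: "dist (P l \<zeta>) p0 < \<delta>" "dist (P l \<zeta>) p0 < r / 2" "0 < l" "l \<le> l0"
    "norm (\<zeta> - l *\<^sub>R P l \<zeta>) \<le> D * l"
    if "(l, \<zeta>) \<in> admissible \<alpha> l0" for l \<zeta>
  proof -
    have "(l, \<zeta>) \<in> admissible \<alpha> l1"
      using that l0(2) by (auto simp: admissible_def)
    then show 1: "dist (P l \<zeta>) p0 < \<delta>" "dist (P l \<zeta>) p0 < r / 2"
      using al(3) by fastforce+
    show l: "0 < l" "l \<le> l0"
      using that by (auto simp: admissible_def)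
    have "norm (P l \<zeta>) \<le> norm p0 + r"
      using 1(2) norm_triangle_ineq2[of "P l \<zeta>" p0] r(1) by (simp add: dist_norm)
    then have "l * norm (P l \<zeta>) \<le> l * (norm p0 + r)"
      using l by simp
    moreover have "norm (\<zeta> - l *\<^sub>R P l \<zeta>) \<le> norm \<zeta> + l * norm (P l \<zeta>)"
      using norm_triangle_ineq4[of \<zeta> "l *\<^sub>R P l \<zeta>"] l by simp
    moreover have "norm \<zeta> \<le> \<alpha> * l"
      using that by (auto simp: admissible_def)
    ultimately show "norm (\<zeta> - l *\<^sub>R P l \<zeta>) \<le> D * l"
      by (simp add: D_def algebra_simps)
  qed

  \<comment> \<open>Selection of the points\<close>
  define near_sat where "near_sat = (\<lambda>l \<zeta> i u. u \<in> usphere \<and> dist u (w0 i) < r / 2 \<and> P l \<zeta> \<bullet> k u = \<sigma> i)"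
  \<comment> \<open>At this stage a saturated point near \<open>w0 i\<close> may be missing. The
    default \<open>w0 i\<close> still gives \<open>N\<close> distinct points of the sphere, so the
    weights can be estimated first; \<open>saturated\<close> later shows that the selected points
    are all saturated.\<close>
  define w where "w = (\<lambda>l \<zeta> i. if \<exists>u. near_sat l \<zeta> i u then SOME u. near_sat l \<zeta> i u else w0 i)"
  have w_sat: "near_sat l \<zeta> i (w l \<zeta> i)" if "near_sat l \<zeta> i u" for l \<zeta> i u
    using that someI[of "near_sat l \<zeta> i" u] by (auto simp: w_def)
  have w_near: "w l \<zeta> i \<in> usphere \<and> dist (w l \<zeta> i) (w0 i) < r / 2" if "i \<in> I" for l \<zeta> i
  proof (cases "\<exists>u. near_sat l \<zeta> i u")
    case True
    then have "near_sat l \<zeta> i (w l \<zeta> i)"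
      using w_sat by blast
    then show ?thesis
      unfolding near_sat_def by blast
  next
    case False
    then have "w l \<zeta> i = w0 i"
      unfolding w_def by (rule if_not_P)
    then show ?thesis
      using w0s[OF that] r(1) by simp
  qed
  have w_inj: "inj_on (w l \<zeta>) I" for l \<zeta>
  proof (rule inj_onI, rule ccontr)
    fix i j assume ij: "i \<in> I" "j \<in> I" "w l \<zeta> i = w l \<zeta> j" "i \<noteq> j"
    have "dist (w0 i) (w0 j) \<le> dist (w l \<zeta> i) (w0 i) + dist (w l \<zeta> i) (w0 j)"
      by (metis dist_commute dist_triangle)
    then show False
      using w_near[OF ij(1), of l \<zeta>] w_near[OF ij(2), of l \<zeta>] sep[OF ij(1,2,4)] ij(3) by simp
  qed
  have w_sub: "w l \<zeta> ` I \<subseteq> usphere" for l \<zeta>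
    using w_near by blast
  have sat_in: "\<exists>i\<in>I. u = w l \<zeta> i \<and> P l \<zeta> \<bullet> k u = \<sigma> i"
    if a: "(l, \<zeta>) \<in> admissible \<alpha> l0" and u: "u \<in> usphere" "\<bar>P l \<zeta> \<bullet> k u\<bar> = 1" for l \<zeta> u
  proof -
    obtain i where i: "i \<in> I" "dist u (w0 i) < r / 2" "P l \<zeta> \<bullet> k u = \<sigma> i"
      using \<delta>(2)[OF adm(1)[OF a] u] by blast
    then have "near_sat l \<zeta> i u"
      using u by (simp add: near_sat_def)
    from w_sat[OF this] have wi: "w l \<zeta> i \<in> usphere" "dist (w l \<zeta> i) (w0 i) < r / 2" "P l \<zeta> \<bullet> k (w l \<zeta> i) = \<sigma> i"
      by (simp_all add: near_sat_def)
    have feas: "dual_feasible x (P l \<zeta>)"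
      unfolding P_def by (rule training_solutions(1)[OF adm(3)[OF a]])
    have half: "r / 2 < r"
      using r(1) by simp
    have "u = w l \<zeta> i"
      by (rule r(2)[OF i(1), unfolded local_uniq_def, rule_format, OF feas less_trans[OF adm(2)[OF a] half]
            u(1) wi(1) less_trans[OF i(2) half] less_trans[OF wi(2) half] i(3) wi(3)])
    then show ?thesis
      using i by blast
  qed

  \<comment> \<open>Weights of an arbitrary solution\<close>
  have stable: "(\<Sum>i\<in>I. \<bar>c i * \<sigma> i - c0 i * \<sigma> i\<bar>) \<le> 2 * M * (D * l + e * S0)"
    if a: "(l, \<zeta>) \<in> admissible \<alpha> l0"
      and mu: "training_solution x l (y0 + \<zeta>) (\<lambda>A. \<Sum>i\<in>I. c i * \<sigma> i * dirac (w l \<zeta> i) A)"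
      and e: "M * e \<le> 1/2" "\<And>i. i \<in> I \<Longrightarrow> C * dist (w l \<zeta> i) (w0 i) \<le> e" "e \<ge> 0" for l \<zeta> c e
  proof -
    \<comment> \<open>Primal optimality fixes the data residual. The displacement bound
      \<open>e\<close> is left free because the estimate serves twice: with the constant
      \<open>C * r\<close> for positivity, and with a vanishing \<open>e\<close> for the
      limit.\<close>
    have "K_op x (\<lambda>A. \<Sum>i\<in>I. c i * \<sigma> i * dirac (w l \<zeta> i) A) = y0 + \<zeta> - l *\<^sub>R P l \<zeta>"
      using training_solutions(4)[OF adm(3)[OF a] mu] by (simp add: P_def)
    then have "(\<Sum>i\<in>I. (c i * \<sigma> i) *\<^sub>R k (w l \<zeta> i)) - y0 = \<zeta> - l *\<^sub>R P l \<zeta>"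
      using K_op_discrete[OF finI w_inj w_sub, where x = x and a = "\<lambda>i. c i * \<sigma> i"] by (simp add: k_def)
    then have "norm ((\<Sum>i\<in>I. (c i * \<sigma> i) *\<^sub>R k (w l \<zeta> i)) - (\<Sum>i\<in>I. (c0 i * \<sigma> i) *\<^sub>R k (w0 i))) \<le> D * l"
      using adm(5)[OF a] by (simp flip: y0_eq)
    moreover have "(\<Sum>i\<in>I. \<bar>c i * \<sigma> i - c0 i * \<sigma> i\<bar>) \<le> 2 * M *
       (norm ((\<Sum>i\<in>I. (c i * \<sigma> i) *\<^sub>R k (w l \<zeta> i)) - (\<Sum>i\<in>I. (c0 i * \<sigma> i) *\<^sub>R k (w0 i))) + e * S0)"
      using coefficients_stable[OF M e(1), of "\<lambda>i. k (w l \<zeta> i)" "\<lambda>i. c i * \<sigma> i" "\<lambda>i. c0 i * \<sigma> i"]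
        e(2,3) order_trans[OF C(2)] S0(2) by simp
    moreover have "2 * M * (norm ((\<Sum>i\<in>I. (c i * \<sigma> i) *\<^sub>R k (w l \<zeta> i)) - (\<Sum>i\<in>I. (c0 i * \<sigma> i) *\<^sub>R k (w0 i))) + e * S0)
       \<le> 2 * M * (D * l + e * S0)"
      using calculation(1) M(1) by (intro mult_left_mono) auto
    ultimately show ?thesis
      by linarith
  qed
  have solutions: "\<exists>c. \<mu> = (\<lambda>A. \<Sum>i\<in>I. c i * \<sigma> i * dirac (w l \<zeta> i) A) \<and>
      (\<forall>i\<in>I. c i > 0 \<and> P l \<zeta> \<bullet> k (w l \<zeta> i) = \<sigma> i)"
    if a: "(l, \<zeta>) \<in> admissible \<alpha> l0" and mu: "training_solution x l (y0 + \<zeta>) \<mu>" for l \<zeta> \<mu>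
  proof -
    note ts = training_solutions(4)[OF adm(3)[OF a] mu]
    have mus: "\<mu> \<in> sphere_measures" "signed_integral \<mu> (K_adj x (P l \<zeta>)) = tv_norm \<mu>"
      using ts by (simp_all add: P_def)
    have feas: "\<bar>K_adj x (P l \<zeta>) u\<bar> \<le> 1" if "u \<in> usphere" for u
      unfolding P_def K_adj_eq_inner
      by (rule bspec[OF iffD1[OF dual_feasible_iff training_solutions(1)[OF adm(3)[OF a]]] that])
    have null: "\<mu> B = 0" if "B \<in> sets sphere_borel" "\<And>u. u \<in> B \<Longrightarrow> \<bar>P l \<zeta> \<bullet> k u\<bar> \<noteq> 1" for B
    proof (rule signed_integral_le_tv_norm(2)[OF mus(1) continuous_on_K_adj feas mus(2) that(1)])
      fix u assume "u \<in> B"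
      then show "\<bar>K_adj x (P l \<zeta>) u\<bar> < 1"
        using that(2)[of u] feas[of u] sets_sphere_borel_subset[OF that(1)]
        by (auto simp: K_adj_eq_inner k_def)
    qed
    define c where "c = (\<lambda>i. \<mu> {w l \<zeta> i} * \<sigma> i)"
    have cs: "c i * \<sigma> i = \<mu> {w l \<zeta> i}" if "i \<in> I" for i
      using sg(1)[OF that] by (simp add: c_def mult.assoc)
    have "\<mu> = (\<lambda>A. \<Sum>i\<in>I. \<mu> {w l \<zeta> i} * dirac (w l \<zeta> i) A)"
    proof (rule sphere_measure_eq_discrete[OF mus(1) finI w_inj w_sub])
      fix B assume B: "B \<in> sets sphere_borel" "B \<inter> w l \<zeta> ` I = {}"
      show "\<mu> B = 0"
        using sat_in[OF a] B sets_sphere_borel_subset[OF B(1)] by (intro null[OF B(1)]) blast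
    qed
    then have eq: "\<mu> = (\<lambda>A. \<Sum>i\<in>I. c i * \<sigma> i * dirac (w l \<zeta> i) A)"
      by (simp add: cs cong: sum.cong)
    have bound: "(\<Sum>i\<in>I. \<bar>c i * \<sigma> i - c0 i * \<sigma> i\<bar>) \<le> 2 * M * (D * l + C * r * S0)"
    proof (rule stable[OF a mu[unfolded eq]])
      show "M * (C * r) \<le> 1/2"
        using r(4) by simp
      show "C * dist (w l \<zeta> i) (w0 i) \<le> C * r" if "i \<in> I" for i
        using w_near[OF that, of l \<zeta>] C(1) r(1) by (intro mult_left_mono) auto
      show "0 \<le> C * r"
        using C(1) r(1) by simp
    qed
    have "c i > 0 \<and> P l \<zeta> \<bullet> k (w l \<zeta> i) = \<sigma> i" if i: "i \<in> I" for i
    proof -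
      have "\<bar>c i - c0 i\<bar> = \<bar>c i * \<sigma> i - c0 i * \<sigma> i\<bar>"
        using sg(2)[OF i] by (simp add: abs_mult flip: left_diff_distrib)
      also have "\<dots> \<le> (\<Sum>i\<in>I. \<bar>c i * \<sigma> i - c0 i * \<sigma> i\<bar>)"
        using i finI by (intro member_le_sum) auto
      also have "\<dots> \<le> 2 * M * D * l + 2 * M * C * S0 * r"
        using bound by (simp add: algebra_simps)
      also have "2 * M * D * l \<le> 2 * M * D * l0"
        using adm(4)[OF a] M(1) al(1) r(1) by (intro mult_left_mono) (auto simp: D_def)
      \<comment> \<open>The residual error is below \<open>c0 i / 2\<close> by the choice of
        \<open>l0\<close>, and the displacement error by the choice of \<open>r\<close>.\<close>
      finally have c: "c i > 0"
        using l0(3)[OF i] r(3)[OF i] by linarith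
      then have "\<mu> {w l \<zeta> i} \<noteq> 0"
        using cs[OF i] sg(2)[OF i] by auto
      moreover have wi: "w l \<zeta> i \<in> usphere"
        using w_near[OF i] by blast
      ultimately have "\<bar>P l \<zeta> \<bullet> k (w l \<zeta> i)\<bar> = 1"
        using null[OF sets_sphere_borel_singleton[OF wi]] by blast
      \<comment> \<open>Only some index \<open>j\<close> is known to match the point and its sign;
        injectivity identifies it with \<open>i\<close>.\<close>
      then obtain j where "j \<in> I" "w l \<zeta> i = w l \<zeta> j" "P l \<zeta> \<bullet> k (w l \<zeta> i) = \<sigma> j"
        using sat_in[OF a wi] by blast
      then show ?thesis
        using c inj_onD[OF w_inj _ i] by metis
    qed
    then show ?thesis
      using eq by blast
  qed
  have saturated: "P l \<zeta> \<bullet> k (w l \<zeta> i) = \<sigma> i" if "(l, \<zeta>) \<in> admissible \<alpha> l0" "i \<in> I" for l \<zeta> i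
    using training_solutions(3)[OF adm(3)[OF that(1)]] solutions[OF that(1)] that(2) by blast
  have represents: "represents_solutions x N \<sigma> l (y0 + \<zeta>) (w l \<zeta>)"
    if "(l, \<zeta>) \<in> admissible \<alpha> l0" for l \<zeta>
    unfolding represents_def
    using w_near solutions[OF that] by (simp add: K_adj_eq_inner P_def k_def)

  \<comment> \<open>Uniqueness of the points\<close>
  have unique: "\<exists>\<tau>. \<tau> permutes I \<and> (\<forall>i\<in>I. w' i = w l \<zeta> (\<tau> i))"
    if a: "(l, \<zeta>) \<in> admissible \<alpha> l0" and w': "represents_solutions x N \<sigma> l (y0 + \<zeta>) w'" for l \<zeta> w'
  proof -
    \<comment> \<open>An actual solution is essential here: \<open>represents_solutions\<close>
      would be vacuous without one.\<close>
    obtain \<mu> where mu: "training_solution x l (y0 + \<zeta>) \<mu>"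
      using training_solutions(3)[OF adm(3)[OF a]] by blast
    obtain c where c: "\<mu> = (\<lambda>A. \<Sum>i\<in>I. c i * \<sigma> i * dirac (w l \<zeta> i) A)" "\<And>i. i \<in> I \<Longrightarrow> c i > 0"
      using solutions[OF a mu] by blast
    obtain c' where c': "\<mu> = (\<lambda>A. \<Sum>i\<in>I. c' i * \<sigma> i * dirac (w' i) A)"
      "\<And>i. i \<in> I \<Longrightarrow> P l \<zeta> \<bullet> k (w' i) = \<sigma> i"
      using w' mu unfolding represents_def P_def K_adj_eq_inner k_def by blast
    have "\<exists>j\<in>I. w' i = w l \<zeta> j" if i: "i \<in> I" for i
    proof -
      have "w' i \<in> usphere"
        using w' i by (simp add: represents_def)
      then show ?thesis
        using sat_in[OF a, of "w' i"] c'(2)[OF i] sg(2)[OF i] by auto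
    qed
    then obtain t where t: "\<And>i. i \<in> I \<Longrightarrow> t i \<in> I" "\<And>i. i \<in> I \<Longrightarrow> w' i = w l \<zeta> (t i)"
      by metis
    \<comment> \<open>Positivity of the weights gives \<mu> a genuine atom at every
      \<open>w l \<zeta> j\<close>, and the representation by \<open>w'\<close> must reproduce it.
      On a finite index set this surjectivity makes \<open>t\<close> a permutation.\<close>
    have "I \<subseteq> t ` I"
    proof
      fix j assume j: "j \<in> I"
      have "\<mu> {w l \<zeta> j} = c j * \<sigma> j"
        unfolding c(1) using discrete_singleton[OF finI w_inj w_sub j] by simp
      then have "\<mu> {w l \<zeta> j} \<noteq> 0"
        using c(2)[OF j] sg(2)[OF j] by auto
      then obtain i where i: "i \<in> I" "dirac (w' i) {w l \<zeta> j} \<noteq> 0"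
        unfolding c'(1) by (metis (no_types, lifting) mult_eq_0_iff sum.neutral)
      then have "w' i = w l \<zeta> j"
        by (auto simp: dirac_def indicator_def split: if_splits)
      then have "t i = j"
        using t[OF i(1)] inj_onD[OF w_inj _ _ j] by metis
      then show "j \<in> t ` I"
        using i(1) by blast
    qed
    then have img: "t ` I = I"
      using t(1) by blast
    then have "inj_on t I"
      using finI by (intro eq_card_imp_inj_on) auto
    define \<tau> where "\<tau> = (\<lambda>i. if i \<in> I then t i else i)"
    have "bij_betw \<tau> I I"
      using img \<open>inj_on t I\<close> by (simp add: bij_betw_def \<tau>_def cong: inj_on_cong image_cong)
    then have "\<tau> permutes I"
      by (intro bij_imp_permutes) (auto simp: \<tau>_def)
    moreover have "\<forall>i\<in>I. w' i = w l \<zeta> (\<tau> i)"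
      using t(2) by (simp add: \<tau>_def)
    ultimately show ?thesis
      by blast
  qed

  \<comment> \<open>Limits of points and weights\<close>
  have w_lim: "((\<lambda>(l, \<zeta>). w l \<zeta> i) \<longlongrightarrow> w0 i) (at (0, 0) within admissible \<alpha> l0)" if i: "i \<in> I" for i
  proof (rule saturated_points_converge[OF p0_max r(1)])
    fix q u assume q: "dual_feasible x q" "p0 \<bullet> y0 \<le> q \<bullet> y0" "dist q p0 < r" "u \<in> usphere"
      "dist u (w0 i) < r" "q \<bullet> kvec x u = \<sigma> i"
    \<comment> \<open>A limit dual vector \<open>q\<close> is a maximiser, so it is saturated at
      \<open>w0 i\<close> as well, and local uniqueness compares \<open>u\<close> with
      \<open>w0 i\<close> for this same \<open>q\<close>.\<close>
    then show "u = w0 i"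
      using r(2)[OF i] saturated_w0[OF q(1,2) i] w0s[OF i] r(1)
      unfolding local_uniq_def k_def by (metis dist_self)
  next
    fix l and \<zeta> :: "real^'n" assume a: "(l, \<zeta>) \<in> admissible \<alpha> l0"
    show "dist (training_dual_solution x l (y0 + \<zeta>)) p0 < r / 2 \<and> w l \<zeta> i \<in> usphere \<and>
        dist (w l \<zeta> i) (w0 i) < r / 2 \<and> training_dual_solution x l (y0 + \<zeta>) \<bullet> kvec x (w l \<zeta> i) = \<sigma> i"
      using adm(2)[OF a] w_near[OF i, of l \<zeta>] saturated[OF a i] by (simp add: P_def k_def)
  qed
  have c_lim: "((\<lambda>(l, \<zeta>). c l \<zeta> i) \<longlongrightarrow> c0 i) (at (0, 0) within admissible \<alpha> l0)"
    if c: "\<And>l \<zeta>. (l, \<zeta>) \<in> admissible \<alpha> l0 \<Longrightarrow>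
        training_solution x l (y0 + \<zeta>) (\<lambda>A. \<Sum>i\<in>I. c l \<zeta> i * \<sigma> i * dirac (w l \<zeta> i) A)"
      and i: "i \<in> I" for c i
  proof -
    let ?F = "at (0 :: real, 0 :: real^'n) within admissible \<alpha> l0"
    \<comment> \<open>Summing over all indices gives one bound that dominates each displacement
      \<open>C * dist\<close> and tends to 0 by \<open>w_lim\<close>.\<close>
    define e where "e = (\<lambda>q. C * (\<Sum>i\<in>I. dist (w (fst q) (snd q) i) (w0 i)))"
    have e_nonneg: "e q \<ge> 0" for q
      using C(1) by (simp add: e_def sum_nonneg)
    have "((\<lambda>q. w (fst q) (snd q) j) \<longlongrightarrow> w0 j) ?F" if "j \<in> I" for j
      using w_lim[OF that] by (simp add: case_prod_unfold)
    then have "(e \<longlongrightarrow> C * (\<Sum>i\<in>I. dist (w0 i) (w0 i))) ?F"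
      unfolding e_def by (intro tendsto_intros)
    then have e: "(e \<longlongrightarrow> 0) ?F"
      by simp
    have "(fst \<longlongrightarrow> (0 :: real)) ?F"
      using tendsto_fst[OF tendsto_ident_at, of "(0 :: real, 0 :: real^'n)" "admissible \<alpha> l0"] by simp
    then have lim: "((\<lambda>q. 2 * M * (D * fst q + e q * S0)) \<longlongrightarrow> 0) ?F"
      using e by (auto intro!: tendsto_eq_intros)
    have "((\<lambda>q. M * e q) \<longlongrightarrow> 0) ?F"
      using e by (auto intro!: tendsto_eq_intros)
    then have "\<forall>\<^sub>F q in ?F. M * e q < 1/2"
      by (rule order_tendstoD(2)) simp
    moreover have "\<forall>\<^sub>F q in ?F. q \<in> admissible \<alpha> l0"
      by (simp add: eventually_at_filter)
    ultimately have "\<forall>\<^sub>F q in ?F. norm (c (fst q) (snd q) i - c0 i) \<le> 2 * M * (D * fst q + e q * S0)"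
    proof eventually_elim
      case (elim q)
      have a: "(fst q, snd q) \<in> admissible \<alpha> l0"
        using elim by simp
      have "norm (c (fst q) (snd q) i - c0 i) = \<bar>c (fst q) (snd q) i * \<sigma> i - c0 i * \<sigma> i\<bar>"
        using sg(2)[OF i] by (simp add: abs_mult flip: left_diff_distrib)
      also have "\<dots> \<le> (\<Sum>i\<in>I. \<bar>c (fst q) (snd q) i * \<sigma> i - c0 i * \<sigma> i\<bar>)"
        using i finI by (intro member_le_sum) auto
      also have "\<dots> \<le> 2 * M * (D * fst q + e q * S0)"
      proof (rule stable[OF a c[OF a]])
        show "M * e q \<le> 1/2"
          using elim by simp
        show "C * dist (w (fst q) (snd q) j) (w0 j) \<le> e q" if "j \<in> I" for j
          unfolding e_def using that C(1) finI
          by (intro mult_left_mono member_le_sum[of j I "\<lambda>i. dist (w (fst q) (snd q) i) (w0 i)"]) auto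
      qed (rule e_nonneg)
      finally show ?case .
    qed
    then have "((\<lambda>q. c (fst q) (snd q) i - c0 i) \<longlongrightarrow> 0) ?F"
      by (rule Lim_null_comparison[OF _ lim])
    then show ?thesis
      unfolding case_prod_unfold by (rule LIM_zero_cancel)
  qed
  show ?thesis
    unfolding I_def[symmetric]
  proof (rule exI[of _ \<alpha>], intro conjI al(1), rule exI[of _ l0], intro conjI l0(1),
      rule exI[of _ w], intro conjI)
    show "\<forall>(l, \<zeta>)\<in>admissible \<alpha> l0. represents_solutions x N \<sigma> l (y0 + \<zeta>) (w l \<zeta>) \<and>
        (\<forall>w'. represents_solutions x N \<sigma> l (y0 + \<zeta>) w' \<longrightarrow>
          (\<exists>\<tau>. \<tau> permutes I \<and> (\<forall>i\<in>I. w' i = w l \<zeta> (\<tau> i))))"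
      using represents unique by auto
    show "\<forall>i\<in>I. ((\<lambda>(l, \<zeta>). w l \<zeta> i) \<longlongrightarrow> w0 i) (at (0, 0) within admissible \<alpha> l0)"
      using w_lim by blast
    show "\<forall>c. (\<forall>(l, \<zeta>)\<in>admissible \<alpha> l0. (\<forall>i\<in>I. c l \<zeta> i > 0) \<and>
          training_solution x l (y0 + \<zeta>) (\<lambda>A. \<Sum>i\<in>I. c l \<zeta> i * \<sigma> i * dirac (w l \<zeta> i) A)) \<longrightarrow>
        (\<forall>i\<in>I. ((\<lambda>(l, \<zeta>). c l \<zeta> i) \<longlongrightarrow> c0 i) (at (0, 0) within admissible \<alpha> l0))"
    proof (intro allI impI ballI)
      fix c i
      assume *: "\<forall>(l, \<zeta>)\<in>admissible \<alpha> l0. (\<forall>i\<in>I. c l \<zeta> i > 0) \<and>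
          training_solution x l (y0 + \<zeta>) (\<lambda>A. \<Sum>i\<in>I. c l \<zeta> i * \<sigma> i * dirac (w l \<zeta> i) A)" and "i \<in> I"
      show "((\<lambda>(l, \<zeta>). c l \<zeta> i) \<longlongrightarrow> c0 i) (at (0, 0) within admissible \<alpha> l0)"
        by (rule c_lim[OF _ \<open>i \<in> I\<close>]) (use * in blast)
    qed
  qed
qed

end
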